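(* Let $n,k$ be positive integers with $n \geq \frac{3k^2+k+2}{2}$. Then the scramble number and the gonality of the Kneser graph $KG(n,k)$ satisfy $$\operatorname{sn}(KG(n,k)) = \operatorname{gon}(KG(n,k)) = \binom{n-1}{k}.$$
   Context: Kneser graph: $KG(n,k)$ is the simple graph whose vertices are the $k$-element subsets of $[n]=\{1,\dots,n\}$, two vertices being adjacent if and only if the subsets are disjoint. Gonality: let $G$ be a finite connected simple graph. A divisor on $G$ is a function $D:V(G)\to\mathbb{Z}$; its degree is $\deg(D)=\sum_{v}D(v)$; it is effective if $D(v)\ge 0$ for all $v$. Firing a vertex $v$ replaces $D$ by the divisor obtained by decreasing $D(v)$ by the number of neighbours of $v$ and increasing $D(w)$ by $1$ for each neighbour $w$ of $v$. Two divisors are equivalent if one is obtained from the other by a finite sequence of firings. The rank $\operatorname{rk}(D)$ is $-1$ if $D$ is not equivalent to an effective divisor, and otherwise is the largest integer $r\ge 0$ such that $D-E$ is equivalent to an effective divisor for every effective divisor $E$ of degree $r$. The gonality is $\operatorname{gon}(G)=\min\{\deg(D):\operatorname{rk}(D)\ge 1\}$. Scramble number: an egg is a nonempty set of vertices of $G$ inducing a connected subgraph; a scramble $\mathcal{S}$ is a finite set of eggs. A hitting set of $\mathcal{S}$ is a set of vertices meeting every egg; $h(\mathcal{S})$ is the minimum size of a hitting set. An egg-cut of $\mathcal{S}$ is a set $C$ of edges such that at least two distinct connected components of the graph obtained by deleting $C$ each contain an egg; $e(\mathcal{S})$ is the minimum size of an egg-cut, with $e(\mathcal{S})=\infty$ if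 there is none. The order of $\mathcal{S}$ is $\min\{h(\mathcal{S}),e(\mathcal{S})\}$, and $\operatorname{sn}(G)$ is the maximum order of a scramble on $G$. *)

theory Defs
  imports Complex_Main "HOL-Library.Extended_Nat"
begin

section \<open>Finite simple graphs\<close>

text \<open>A simple graph is given by its vertex set and its set of edges, an edge being a two-element
  set of vertices. Sizes of edge sets therefore count undirected edges.\<close>

record 'a sgraph =
  verts :: "'a set"
  edges :: "'a set set"

definition neighbours :: "'a sgraph \<Rightarrow> 'a \<Rightarrow> 'a set" where
  "neighbours G v = {w \<in> verts G. {v, w} \<in> edges G}"

definition reachable :: "'a sgraph \<Rightarrow> 'a \<Rightarrow> 'a \<Rightarrow> bool" where
  "reachable G = (\<lambda>u v. {u, v} \<in> edges G)\<^sup>*\<^sup>*"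

definition connected_graph :: "'a sgraph \<Rightarrow> bool" where
  "connected_graph G \<longleftrightarrow> verts G \<noteq> {} \<and> (\<forall>u\<in>verts G. \<forall>v\<in>verts G. reachable G u v)"

definition components :: "'a sgraph \<Rightarrow> 'a set set" where
  "components G = (\<lambda>u. {v \<in> verts G. reachable G u v}) ` verts G"

definition induced_subgraph :: "'a sgraph \<Rightarrow> 'a set \<Rightarrow> 'a sgraph" where
  "induced_subgraph G X = \<lparr>verts = X, edges = {e \<in> edges G. e \<subseteq> X}\<rparr>"

definition delete_edges :: "'a sgraph \<Rightarrow> 'a set set \<Rightarrow> 'a sgraph" where
  "delete_edges G C = \<lparr>verts = verts G, edges = edges G - C\<rparr>"

text \<open>The condition \<open>A \<noteq> B\<close> only matters for \<open>k = 0\<close>, where the empty set is disjoint from itself.\<close>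

definition kneser :: "nat \<Rightarrow> nat \<Rightarrow> nat set sgraph" where
  "kneser n k =
    (let V = {A. A \<subseteq> {1..n} \<and> card A = k}
     in \<lparr>verts = V, edges = {{A, B} | A B. A \<in> V \<and> B \<in> V \<and> A \<noteq> B \<and> A \<inter> B = {}}\<rparr>)"

section \<open>Divisors and gonality\<close>

text \<open>A divisor is a function on the vertex set, represented by its extension by zero.\<close>

definition divisor :: "'a sgraph \<Rightarrow> ('a \<Rightarrow> int) \<Rightarrow> bool" where
  "divisor G D \<longleftrightarrow> (\<forall>v. v \<notin> verts G \<longrightarrow> D v = 0)"

definition deg :: "'a sgraph \<Rightarrow> ('a \<Rightarrow> int) \<Rightarrow> int" where
  "deg G D = (\<Sum>v\<in>verts G. D v)"

definition effective :: "'a sgraph \<Rightarrow> ('a \<Rightarrow> int) \<Rightarrow> bool" where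
  "effective G D \<longleftrightarrow> divisor G D \<and> (\<forall>v\<in>verts G. D v \<ge> 0)"

definition fire :: "'a sgraph \<Rightarrow> 'a \<Rightarrow> ('a \<Rightarrow> int) \<Rightarrow> ('a \<Rightarrow> int)" where
  "fire G v D = (\<lambda>w. if w = v then D w - int (card (neighbours G v))
                     else if w \<in> neighbours G v then D w + 1
                     else D w)"

definition firing_sequence :: "'a sgraph \<Rightarrow> ('a \<Rightarrow> int) \<Rightarrow> ('a \<Rightarrow> int) \<Rightarrow> bool" where
  "firing_sequence G = (\<lambda>D D'. \<exists>v\<in>verts G. D' = fire G v D)\<^sup>*\<^sup>*"

text \<open>Either disjunct alone gives the same relation on a finite simple graph: firing every vertex once changes
  nothing, so a firing at \<open>v\<close> is undone by firing all the other vertices.\<close>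

definition div_equiv :: "'a sgraph \<Rightarrow> ('a \<Rightarrow> int) \<Rightarrow> ('a \<Rightarrow> int) \<Rightarrow> bool" where
  "div_equiv G D D' \<longleftrightarrow> firing_sequence G D D' \<or> firing_sequence G D' D"

definition equiv_to_effective :: "'a sgraph \<Rightarrow> ('a \<Rightarrow> int) \<Rightarrow> bool" where
  "equiv_to_effective G D \<longleftrightarrow> (\<exists>D'. effective G D' \<and> div_equiv G D D')"

text \<open>The greatest \<open>r\<close> exists when the graph is finite and nonempty, since every admissible \<open>r\<close>
  is then at most the degree of \<open>D\<close>.\<close>

definition rk :: "'a sgraph \<Rightarrow> ('a \<Rightarrow> int) \<Rightarrow> int" where
  "rk G D =
    (if \<not> equiv_to_effective G D then -1
     else (GREATEST r. r \<ge> 0 \<and>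
       (\<forall>E. effective G E \<and> deg G E = r \<longrightarrow> equiv_to_effective G (\<lambda>v. D v - E v))))"

text \<open>The least degree exists when the graph is finite and nonempty: a divisor of rank at least 1 has
  degree at least 1, and the divisor with value 1 at every vertex has rank at least 1.\<close>

definition gon :: "'a sgraph \<Rightarrow> int" where
  "gon G = (LEAST d. \<exists>D. divisor G D \<and> rk G D \<ge> 1 \<and> deg G D = d)"

section \<open>Scramble number\<close>

definition egg :: "'a sgraph \<Rightarrow> 'a set \<Rightarrow> bool" where
  "egg G X \<longleftrightarrow> X \<noteq> {} \<and> X \<subseteq> verts G \<and> connected_graph (induced_subgraph G X)"

definition scramble :: "'a sgraph \<Rightarrow> 'a set set \<Rightarrow> bool" where
  "scramble G S \<longleftrightarrow> finite S \<and> (\<forall>X\<in>S. egg G X)"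

definition hitting_set :: "'a sgraph \<Rightarrow> 'a set set \<Rightarrow> 'a set \<Rightarrow> bool" where
  "hitting_set G S H \<longleftrightarrow> H \<subseteq> verts G \<and> (\<forall>X\<in>S. X \<inter> H \<noteq> {})"

definition hitting_number :: "'a sgraph \<Rightarrow> 'a set set \<Rightarrow> nat" where
  "hitting_number G S = (LEAST m. \<exists>H. hitting_set G S H \<and> card H = m)"

definition egg_cut :: "'a sgraph \<Rightarrow> 'a set set \<Rightarrow> 'a set set \<Rightarrow> bool" where
  "egg_cut G S C \<longleftrightarrow> C \<subseteq> edges G \<and>
    (\<exists>A\<in>components (delete_edges G C). \<exists>B\<in>components (delete_edges G C).
      A \<noteq> B \<and> (\<exists>X\<in>S. X \<subseteq> A) \<and> (\<exists>Y\<in>S. Y \<subseteq> B))"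

text \<open>In \<^typ>\<open>enat\<close> the infimum of a nonempty set is attained, and the infimum of the empty
  set is \<open>\<infinity>\<close>.\<close>

definition egg_cut_number :: "'a sgraph \<Rightarrow> 'a set set \<Rightarrow> enat" where
  "egg_cut_number G S = Inf {enat (card C) | C. egg_cut G S C}"

definition scramble_order :: "'a sgraph \<Rightarrow> 'a set set \<Rightarrow> enat" where
  "scramble_order G S = min (enat (hitting_number G S)) (egg_cut_number G S)"

text \<open>On a finite graph there are only finitely many scrambles, so this is a genuine maximum.\<close>

definition sn :: "'a sgraph \<Rightarrow> enat" where
  "sn G = Max {scramble_order G S | S. scramble G S}"

end

theory Submission
  imports Defs "HOL-Combinatorics.Permutations"
begin

text \<open>The lower bound comes from the scramble whose eggs are the edges of \<open>KG(n,k)\<close>. The complement of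
  a hitting set is an intersecting family, so Erdos--Ko--Rado (by Katona's cycle argument) gives the
  hitting number \<open>(n-1) choose k\<close>. The hypothesis on \<open>n\<close> makes the degree \<open>d = (n-k) choose k\<close>
  exceed half the number \<open>N\<close> of vertices. Hence a set \<open>U\<close> with \<open>2 \<le> |U| \<le> N/2\<close> sends at least
  \<open>|U| (d - |U| + 1) \<ge> 2 (d - 1) \<ge> N - 1\<close> edges to its complement, which bounds the egg-cuts.
  The scramble number is at most the gonality on every graph, and the complement of the independent
  set of all \<open>k\<close>-sets containing \<open>n\<close> is a divisor of rank at least 1 and degree \<open>(n-1) choose k\<close>.\<close>

section \<open>The Erdos--Ko--Rado theorem\<close>

definition arc :: "nat \<Rightarrow> nat \<Rightarrow> nat \<Rightarrow> nat set" where
  "arc n k i = (\<lambda>j. (i + j) mod n) ` {..<k}"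

text \<open>The number of forward steps from \<open>i\<close> to \<open>j\<close> on the cycle of
  residues below \<open>n\<close>. The case split in place of \<open>mod\<close> keeps it within
  linear arithmetic.\<close>

definition cdist :: "nat \<Rightarrow> nat \<Rightarrow> nat \<Rightarrow> nat" where
  "cdist n i j = (if i \<le> j then j - i else j + n - i)"

lemma cdist_inj: "c < n \<Longrightarrow> i < n \<Longrightarrow> j < n \<Longrightarrow> cdist n c i = cdist n c j \<Longrightarrow> i = j"
  unfolding cdist_def by (simp split: if_splits)

lemma cdist_diff:
  "c < n \<Longrightarrow> i < n \<Longrightarrow> j < n \<Longrightarrow> cdist n c i \<le> cdist n c j \<Longrightarrow>
    cdist n i j = cdist n c j - cdist n c i"
  unfolding cdist_def by (simp split: if_splits)

lemma card_arc:
  assumes "k \<le> n"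
  shows "card (arc n k i) = k"
proof -
  have "inj_on (\<lambda>j. (i + j) mod n) {..<k}"
  proof (rule linorder_inj_onI')
    fix a b assume "a \<in> {..<k}" "b \<in> {..<k}" "a < b"
    with assms have "b - a < n" "0 < b - a"
      by auto
    then have "\<not> n dvd b - a"
      by (auto dest: dvd_imp_le)
    then show "(i + a) mod n \<noteq> (i + b) mod n"
      using mod_eq_dvd_iff_nat[of "i + a" "i + b" n] \<open>a < b\<close> by auto
  qed
  then show ?thesis
    by (simp add: arc_def card_image)
qed

text \<open>A common point at offsets \<open>a\<close> and \<open>b\<close> makes the forward
  distance congruent to \<open>a - b\<close> modulo \<open>n\<close>, and \<open>a - b\<close> lies
  strictly between \<open>-k\<close> and \<open>k\<close>.\<close>

lemma arcs_meet:
  assumes "arc n k i \<inter> arc n k j \<noteq> {}" "i < n" "j < n" "k \<le> n"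
  shows "cdist n i j < k \<or> n - k < cdist n i j"
proof -
  obtain a b where ab: "a < k" "b < k" "(i + a) mod n = (j + b) mod n"
    using assms(1) by (auto simp: arc_def)
  have "(c + d) mod n = (if c + d < n then c + d else c + d - n)" if "c < n" "d < n" for c d
    using that by (auto simp: le_mod_geq)
  from this[of i a] this[of j b]
  have "(i + a) mod n = (if i + a < n then i + a else i + a - n)"
       "(j + b) mod n = (if j + b < n then j + b else j + b - n)"
    using assms ab by auto
  then show ?thesis
    using ab assms unfolding cdist_def by (auto split: if_splits)
qed

text \<open>Relative to one arc of the family the others start at a cyclic distance in
  \<open>{1..<k}\<close> or \<open>{n-k<..<n}\<close>. Distances differing by \<open>n - k\<close> belong to disjoint arcs.\<close>

lemma card_intersecting_arcs:
  assumes "2 * k \<le> n" "0 < k" "J \<subseteq> {..<n}"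
    and meet: "\<And>i j. i \<in> J \<Longrightarrow> j \<in> J \<Longrightarrow> arc n k i \<inter> arc n k j \<noteq> {}"
  shows "card J \<le> k"
proof (cases "J = {}")
  case False
  then obtain c where c: "c \<in> J" by blast
  \<comment> \<open>Folds each far distance \<open>n - k + t\<close> onto \<open>t\<close>. The two
    starts sharing a value have disjoint arcs, so \<open>J\<close> contains at most one of
    them.\<close>
  define \<phi> where "\<phi> = (\<lambda>i. if cdist n c i < k then cdist n c i else cdist n c i + k - n)"
  have lt: "i < n" if "i \<in> J" for i using that assms(3) by auto
  have near: "cdist n i j < k \<or> n - k < cdist n i j" if "i \<in> J" "j \<in> J" for i j
    using arcs_meet[OF meet[OF that]] lt that assms(1) by auto
  have mixed: False
    if "i \<in> J" "j \<in> J" "\<phi> i = \<phi> j" "cdist n c i < k" "\<not> cdist n c j < k" for i j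
  proof -
    have "cdist n c j = cdist n c i + (n - k)"
      using that near[OF c that(2)] assms(1) by (simp add: \<phi>_def)
    \<comment> \<open>At this distance the arc of \<open>j\<close> stops right before the arc of
      \<open>i\<close> begins; the two are disjoint because \<open>2 * k \<le> n\<close>.\<close>
    then have "cdist n i j = n - k"
      using cdist_diff[OF lt[OF c] lt[OF that(1)] lt[OF that(2)]] by simp
    then show False
      using near[OF that(1,2)] assms(1) by simp
  qed
  have "\<phi> i < k" if "i \<in> J" for i
    using near[OF c that] lt[OF that] lt[OF c] assms(2) by (auto simp: \<phi>_def cdist_def)
  moreover have "inj_on \<phi> J"
  proof (rule inj_onI)
    fix i j assume ij: "i \<in> J" "j \<in> J" "\<phi> i = \<phi> j"
    have "cdist n c i = cdist n c j"
    proof (cases "cdist n c i < k \<longleftrightarrow> cdist n c j < k")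
      case True
      then show ?thesis
        using ij(3) near[OF c ij(1)] near[OF c ij(2)] assms(1)
        by (cases "cdist n c j < k") (simp_all add: \<phi>_def)
    next
      case False
      then show ?thesis
        using mixed[OF ij] mixed[OF ij(2,1) ij(3)[symmetric]] by blast
    qed
    then show "i = j"
      by (rule cdist_inj[OF lt[OF c] lt[OF ij(1)] lt[OF ij(2)]])
  qed
  ultimately show ?thesis
    using card_inj_on_le[of \<phi> J "{..<k}"] by auto
qed simp

section \<open>Permutations carrying one set to another\<close>

text \<open>The complements in \<open>S\<close> have equal size too; the two bijections are glued
  and extended by the identity outside \<open>S\<close>.\<close>

lemma permutes_image_exists:
  assumes "finite S" "A \<subseteq> S" "B \<subseteq> S" "card A = card B"
  shows "\<exists>p. p permutes S \<and> p ` A = B"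
proof -
  have fin: "finite A" "finite B"
    using assms finite_subset by auto
  obtain f where f: "bij_betw f A B"
    using finite_same_card_bij[OF fin assms(4)] by blast
  obtain g where g: "bij_betw g (S - A) (S - B)"
    using finite_same_card_bij[of "S - A" "S - B"] assms fin by (auto simp: card_Diff_subset)
  define p where "p = (\<lambda>x. if x \<in> A then f x else if x \<in> S then g x else x)"
  have pA: "bij_betw p A B"
    using f by (rule bij_betw_cong[THEN iffD1, rotated]) (simp add: p_def)
  have "bij_betw p (S - A) (S - B)"
    using g by (rule bij_betw_cong[THEN iffD1, rotated]) (simp add: p_def)
  with pA have "bij_betw p (A \<union> (S - A)) (B \<union> (S - B))"
    by (rule bij_betw_combine) blast
  moreover have "A \<union> (S - A) = S" "B \<union> (S - B) = S"
    using assms by auto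
  ultimately have "p permutes S"
    using assms(2) by (intro bij_imp_permutes) (auto simp: p_def)
  with pA show ?thesis
    by (auto simp: bij_betw_def)
qed

text \<open>Composition with a permutation taking \<open>C\<close> to \<open>C'\<close> injects the
  permutations sending \<open>A\<close> to \<open>C\<close> into those sending \<open>A\<close> to
  \<open>C'\<close>. So all \<open>n choose k\<close> fibres of the map from a permutation to its
  image of \<open>A\<close> have the same size.\<close>

lemma card_permutes_image:
  assumes S: "finite S" "card S = n" and A: "A \<subseteq> S" "card A = k" and B: "B \<subseteq> S" "card B = k"
  shows "card {p. p permutes S \<and> p ` A = B} * (n choose k) = fact n"
proof -
  define V where "V = {C. C \<subseteq> S \<and> card C = k}"
  define P where "P C = {p. p permutes S \<and> p ` A = C}" for C
  have "finite V"
    using S by (simp add: V_def)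
  have fin: "finite {p. p permutes S}"
    using S by (simp add: finite_permutations)
  have le: "card (P C) \<le> card (P C')" if C: "C \<in> V" "C' \<in> V" for C C'
  proof -
    obtain s where s: "s permutes S" "s ` C = C'"
      using permutes_image_exists[of S C C'] S C by (auto simp: V_def)
    have "inj_on (\<lambda>p. s \<circ> p) (P C)"
      using permutes_inj[OF s(1)] by (auto simp: inj_on_def inj_def fun_eq_iff)
    moreover have "(\<lambda>p. s \<circ> p) ` P C \<subseteq> P C'"
      using s by (auto simp: P_def permutes_compose image_comp[symmetric])
    moreover have "finite (P C')"
      using fin by (rule rev_finite_subset) (auto simp: P_def)
    ultimately show ?thesis
      by (rule card_inj_on_le)
  qed
  have "p ` A \<in> V" if "p permutes S" for p
    using image_mono[OF A(1), of p] permutes_image[OF that] card_image[OF permutes_inj_on[OF that], of A] A(2)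
    by (simp add: V_def)
  then have UP: "{p. p permutes S} = (\<Union>C\<in>V. P C)"
    by (auto simp: P_def)
  have "fact n = card (\<Union>C\<in>V. P C)"
    using S by (simp add: UP[symmetric] card_permutations)
  also have "\<dots> = (\<Sum>C\<in>V. card (P C))"
    using fin \<open>finite V\<close> by (intro card_UN_disjoint) (auto simp: P_def)
  also have "\<dots> = (\<Sum>C\<in>V. card (P B))"
    using le B by (intro sum.cong refl antisym) (auto simp: V_def)
  also have "\<dots> = card (P B) * (n choose k)"
    using S n_subsets[of S k] by (simp add: V_def)
  finally show ?thesis
    by (simp add: P_def)
qed

text \<open>Double counting of the pairs of a permutation \<open>p\<close> and a position
  \<open>i\<close> such that \<open>p\<close> carries the arc \<open>B i\<close> into
  \<open>F\<close>: each \<open>p\<close> has at most \<open>k\<close> such positions, and each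
  position has the same number of such \<open>p\<close>. The factor \<open>m\<close> avoids a
  division.\<close>

theorem Erdos_Ko_Rado:
  assumes S: "finite S" "card S = n" and k: "0 < k" "2 * k \<le> n"
    and F: "F \<subseteq> {A. A \<subseteq> S \<and> card A = k}"
    and meet: "\<And>A B. A \<in> F \<Longrightarrow> B \<in> F \<Longrightarrow> A \<inter> B \<noteq> {}"
  shows "card F \<le> (n - 1) choose (k - 1)"
proof -
  obtain h where h: "bij_betw h {..<n} S"
    using ex_bij_betw_nat_finite[OF S(1)] S(2) by (auto simp: atLeast0LessThan)
  define B where "B i = h ` arc n k i" for i
  define P where "P = {p. p permutes S}"
  define m where "m = n choose k"
  have arc_sub: "arc n k i \<subseteq> {..<n}" for i
    using k by (auto simp: arc_def)
  have B: "B i \<subseteq> S" "card (B i) = k" for i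
    using h arc_sub[of i] k card_arc[of k n i]
    by (auto simp: B_def bij_betw_def card_image inj_on_subset)
  have fin: "finite F" "finite P"
    using F S by (auto intro: finite_subset simp: P_def finite_permutations)
  have le_k: "card {i \<in> {..<n}. p ` B i \<in> F} \<le> k" if p: "p \<in> P" for p
  proof (rule card_intersecting_arcs[OF k(2,1)])
    fix i j assume "i \<in> {i \<in> {..<n}. p ` B i \<in> F}" "j \<in> {i \<in> {..<n}. p ` B i \<in> F}"
    then have "p ` B i \<inter> p ` B j \<noteq> {}"
      using meet by blast
    then have "B i \<inter> B j \<noteq> {}"
      using p permutes_inj[of p S] by (auto simp: P_def inj_def)
    then have "h ` (arc n k i \<inter> arc n k j) \<noteq> {}"
      using h inj_on_image_Int[OF _ arc_sub arc_sub] unfolding B_def bij_betw_def by metis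
    then show "arc n k i \<inter> arc n k j \<noteq> {}"
      by blast
  qed auto
  have count: "card {p \<in> P. p ` B i \<in> F} * m = card F * fact n" for i
  proof -
    have "{p \<in> P. p ` B i \<in> F} = (\<Union>A\<in>F. {p. p permutes S \<and> p ` B i = A})"
      by (auto simp: P_def)
    then have "card {p \<in> P. p ` B i \<in> F} = (\<Sum>A\<in>F. card {p. p permutes S \<and> p ` B i = A})"
      using fin by (simp only:) (subst card_UN_disjoint; auto simp: P_def)
    then have "card {p \<in> P. p ` B i \<in> F} * m = (\<Sum>A\<in>F. card {p. p permutes S \<and> p ` B i = A} * m)"
      by (simp add: sum_distrib_right)
    also have "\<dots> = (\<Sum>A\<in>F. fact n)"
      unfolding m_def by (intro sum.cong refl card_permutes_image S B) (use F in auto)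
    finally show ?thesis by simp
  qed
  have "n * card F * fact n = (\<Sum>i<n. card {p \<in> P. p ` B i \<in> F} * m)"
    by (simp add: count)
  also have "\<dots> = (\<Sum>i<n. card {p \<in> P. p ` B i \<in> F}) * m"
    by (simp add: sum_distrib_right)
  also have "(\<Sum>i<n. card {p \<in> P. p ` B i \<in> F}) = (\<Sum>i<n. \<Sum>p\<in>P. if p ` B i \<in> F then 1 else 0)"
    using fin by (simp add: sum.If_cases Int_def)
  also have "\<dots> = (\<Sum>p\<in>P. \<Sum>i<n. if p ` B i \<in> F then 1 else 0)"
    by (rule sum.swap)
  also have "\<dots> = (\<Sum>p\<in>P. card {i \<in> {..<n}. p ` B i \<in> F})"
    by (simp add: sum.If_cases Int_def)
  also have "\<dots> * m \<le> (\<Sum>p\<in>P. k) * m"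
    using le_k by (intro mult_right_mono sum_mono) auto
  also have "\<dots> = k * m * fact n"
    using S by (simp add: P_def card_permutations)
  finally have "n * card F \<le> k * m"
    by simp
  also have "\<dots> = n * ((n - 1) choose (k - 1))"
    using times_binomial_minus1_eq[of k n] k by (simp add: m_def)
  finally show ?thesis
    using k by simp
qed

section \<open>The degree exceeds half the number of vertices\<close>

lemma Suc_times_binomial_Suc: "Suc i * (n choose Suc i) = (n - i) * (n choose i)"
  by (metis binomial_absorb_comp binomial_absorption)

text \<open>From \<open>i\<close> to \<open>Suc i\<close> the first binomial changes by the factor
  \<open>(k - i) / (i + 1)\<close> and the second by \<open>(k - i) / (n - 2 * k + i + 1)\<close>.
  With denominators cleared the case \<open>i \<ge> k\<close> is included, both sides being
  zero.\<close>

lemma Vandermonde_term_ratio: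
  assumes "2 * k \<le> n"
  shows "Suc i * (n - 2 * k + Suc i) * ((k choose Suc i) * ((n - k) choose (k - Suc i)))
       = (k - i)\<^sup>2 * ((k choose i) * ((n - k) choose (k - i)))"
proof (cases "i < k")
  case True
  then have j: "k - i = Suc (k - Suc i)" "n - k - (k - Suc i) = n - 2 * k + Suc i"
    using assms by auto
  have "(k - i) * ((n - k) choose (k - i)) = (n - 2 * k + Suc i) * ((n - k) choose (k - Suc i))"
    using Suc_times_binomial_Suc[of "k - Suc i" "n - k"] unfolding j .
  moreover have "Suc i * (k choose Suc i) = (k - i) * (k choose i)"
    by (rule Suc_times_binomial_Suc)
  ultimately show ?thesis
    unfolding power2_eq_square by (metis mult.assoc mult.left_commute)
qed (simp add: not_less)

text \<open>The three fractions bound the first ratios of consecutive Vandermonde terms at the smallest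
  admissible \<open>n\<close>, where \<open>q = 2 (n - 2 k + 1)\<close>. The last one includes a factor \<open>6 / 5\<close> for the remaining
  terms, which are dominated by a geometric series of ratio \<open>1 / 6\<close>.\<close>

lemma threshold_inequality:
  fixes k :: real
  assumes "k \<ge> 1"
  defines "q \<equiv> 3 * k\<^sup>2 - 3 * k + 4"
  shows "2 * k\<^sup>2 / q * (1 + (k - 1)\<^sup>2 / (q + 2) * (1 + 4 / 5 * (k - 2)\<^sup>2 / (q + 4))) < 1"
proof -
  \<comment> \<open>In terms of \<open>j \<ge> 0\<close> the polynomial that remains is visibly
    positive.\<close>
  define j where "j = k - 1"
  have j: "j \<ge> 0" "k = j + 1"
    using assms(1) by (auto simp: j_def)
  have q: "q = 3 * j\<^sup>2 + 3 * j + 4"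
    by (simp add: q_def j power2_eq_square algebra_simps)
  then have "q > 0"
    using j by (simp add: add_nonneg_pos)
  have "7 * j\<^sup>2 - 45 * j + 99 = 7 * (j - 45 / 14)\<^sup>2 + (99 - 2025 / 28)"
    by (simp add: power2_eq_square algebra_simps)
  then have 1: "j ^ 4 * (7 * j\<^sup>2 - 45 * j + 99) \<ge> 0"
    using j by (intro mult_nonneg_nonneg) auto
  have "2 * j\<^sup>2 - 55 * j + 452 = 2 * (j - 55 / 4)\<^sup>2 + (452 - 3025 / 8)"
    by (simp add: power2_eq_square algebra_simps)
  then have 2: "j\<^sup>2 * (2 * j\<^sup>2 - 55 * j + 452) \<ge> 0"
    by (intro mult_nonneg_nonneg) auto
  \<comment> \<open>The difference of the two sides after clearing denominators. Completed squares
    show the first two summands to be nonnegative, and the constant 480 gives strictness.\<close>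
  have "5 * q * (q + 2) * (q + 4) - 2 * k\<^sup>2 * (5 * (q + 2) * (q + 4)
          + 5 * (k - 1)\<^sup>2 * (q + 4) + 4 * (k - 1)\<^sup>2 * (k - 2)\<^sup>2)
      = j ^ 4 * (7 * j\<^sup>2 - 45 * j + 99) + j\<^sup>2 * (2 * j\<^sup>2 - 55 * j + 452) + 180 * j + 480"
    unfolding q j by (simp add: eval_nat_numeral algebra_simps)
  with 1 2 j have "2 * k\<^sup>2 * (5 * (q + 2) * (q + 4)
          + 5 * (k - 1)\<^sup>2 * (q + 4) + 4 * (k - 1)\<^sup>2 * (k - 2)\<^sup>2) < 5 * q * (q + 2) * (q + 4)"
    by linarith
  moreover have "2 * k\<^sup>2 / q * (1 + (k - 1)\<^sup>2 / (q + 2) * (1 + 4 / 5 * (k - 2)\<^sup>2 / (q + 4)))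
     = (2 * k\<^sup>2 * (5 * (q + 2) * (q + 4)
          + 5 * (k - 1)\<^sup>2 * (q + 4) + 4 * (k - 1)\<^sup>2 * (k - 2)\<^sup>2)) / (5 * q * (q + 2) * (q + 4))"
  \<comment> \<open>Denominators are cleared with free \<open>a\<close>, \<open>b\<close>,
    \<open>c\<close>, \<open>x\<close>, \<open>y\<close>, so that the polynomials in
    \<open>k\<close> stay unexpanded.\<close>
  proof -
    have "2 * a / q * (1 + b / x * (1 + 4 / 5 * c / y)) = 2 * a * (5 * x * y + 5 * b * y + 4 * b * c) / (5 * q * x * y)"
      if "x > 0" "y > 0" for a b c x y :: real
      using that \<open>q > 0\<close> by (simp add: field_simps)
    from this[of "q + 2" "q + 4"] show ?thesis
      using \<open>q > 0\<close> by (simp add: mult.assoc)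
  qed
  ultimately show ?thesis
    using \<open>q > 0\<close> by simp
qed

text \<open>\<open>(n - k) choose k\<close> is the first term of Vandermonde's sum for \<open>n choose k\<close>.\<close>

lemma binomial_less_twice_degree:
  assumes k: "1 \<le> k" and n: "3 * k\<^sup>2 + k + 2 \<le> 2 * n"
  shows "n choose k < 2 * ((n - k) choose k)"
proof -
  \<comment> \<open>\<open>T 0\<close> is the degree and all the \<open>T i\<close> sum to
    \<open>n choose k\<close>, so the terms after the first have to add up to less than
    \<open>T 0\<close>.\<close>
  define T where "T i = real ((k choose i) * ((n - k) choose (k - i)))" for i
  define q where "q = 3 * (real k)\<^sup>2 - 3 * real k + 4"
  have "k \<le> k\<^sup>2"
    using k by (simp add: power2_eq_square)
  then have kn: "2 * k \<le> n" "k \<le> n"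
    using n by auto
  have "real k \<le> (real k)\<^sup>2"
    using k by (simp add: power2_eq_square)
  then have q0: "q \<ge> 4"
    by (simp add: q_def)
  \<comment> \<open>Equality holds when \<open>2 * n = 3 * k^2 + k + 2\<close>, which is where
    \<open>q\<close> comes from.\<close>
  have m: "q \<le> 2 * real (n - 2 * k + 1)"
  proof -
    have "3 * (real k)\<^sup>2 + real k + 2 \<le> 2 * real n"
      using of_nat_mono[OF n, where 'a = real] by simp
    then show ?thesis
      using kn by (simp add: q_def)
  qed
  have T0: "T i \<ge> 0" for i
    by (simp add: T_def)
  have ratio: "T (Suc i) \<le> 2 * (real (k - i))\<^sup>2 / (real (Suc i) * (q + 2 * real i)) * T i" for i
  proof -
    have "real (Suc i * (n - 2 * k + Suc i) * ((k choose Suc i) * ((n - k) choose (k - Suc i))))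
       = real ((k - i)\<^sup>2 * ((k choose i) * ((n - k) choose (k - i))))"
      using Vandermonde_term_ratio[OF kn(1), of i] by (simp only:)
    then have "real (Suc i) * real (n - 2 * k + Suc i) * T (Suc i) = (real (k - i))\<^sup>2 * T i"
      by (simp only: T_def of_nat_mult of_nat_power)
    then have "2 * (real (k - i))\<^sup>2 * T i = real (Suc i) * (2 * real (n - 2 * k + Suc i)) * T (Suc i)"
      by (metis mult.assoc mult.left_commute)
    also have "\<dots> \<ge> real (Suc i) * (q + 2 * real i) * T (Suc i)"
      using m T0 by (intro mult_right_mono mult_left_mono) auto
    finally have "T (Suc i) * (real (Suc i) * (q + 2 * real i)) \<le> 2 * (real (k - i))\<^sup>2 * T i"
      by (simp only: mult.commute)
    moreover have "real (Suc i) * (q + 2 * real i) > 0"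
      using q0 by (intro mult_pos_pos) auto
    ultimately show ?thesis
      by (simp only: times_divide_eq_left pos_le_divide_eq)
  qed
  have T1: "T 1 \<le> 2 * (real k)\<^sup>2 / q * T 0"
    using ratio[of 0] by simp
  have "T 2 \<le> 2 * (real (k - 1))\<^sup>2 / (2 * (q + 2)) * T 1"
    using ratio[of 1] unfolding Suc_1 by simp
  then have "T 2 \<le> (real (k - 1))\<^sup>2 / (q + 2) * T 1"
    by (subst (asm) mult_divide_mult_cancel_left) auto
  then have T2: "T 2 \<le> (real k - 1)\<^sup>2 / (q + 2) * T 1"
    using k by simp
  have "T 3 \<le> 2 * (real (k - 2))\<^sup>2 / (3 * (q + 4)) * T 2"
    using ratio[of 2] unfolding Suc_numeral add_num_simps by simp
  \<comment> \<open>Truncated and real subtraction differ at \<open>k = 1\<close>: the squares are 0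
    and 1, so only an inequality holds.\<close>
  also have "\<dots> \<le> 2 * (real k - 2)\<^sup>2 / (3 * (q + 4)) * T 2"
    using q0 T0 by (intro mult_right_mono divide_right_mono mult_left_mono)
      (auto simp: not_le le_less split: nat_diff_split)
  finally have T3: "T 3 \<le> 2 / 3 * (real k - 2)\<^sup>2 / (q + 4) * T 2"
    by simp
  have tail: "T (3 + i) \<le> T 3 / 6 ^ i" for i
  proof (induction i)
    case (Suc i)
    \<comment> \<open>Since \<open>3 * (k - 1)^2 \<le> q\<close> and
      \<open>Suc (3 + i) \<ge> 4\<close>, the quotient is at most
      \<open>2 / (3 * 4)\<close>.\<close>
    have "2 * (real (k - (3 + i)))\<^sup>2 / (real (Suc (3 + i)) * (q + 2 * real (3 + i))) \<le> 1 / 6"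
    proof -
      have "(real (k - (3 + i)))\<^sup>2 \<le> (real k - 1)\<^sup>2"
        using k by (intro power_mono) auto
      moreover have "3 * (real k - 1)\<^sup>2 \<le> q"
        using k by (simp add: q_def power2_eq_square algebra_simps)
      ultimately have "12 * (real (k - (3 + i)))\<^sup>2 \<le> 4 * (q + 2 * real (3 + i))"
        by simp
      also have "\<dots> \<le> real (Suc (3 + i)) * (q + 2 * real (3 + i))"
        using q0 by (intro mult_right_mono) auto
      finally show ?thesis
        using q0 by (simp add: divide_simps)
    qed
    then have "T (3 + Suc i) \<le> 1 / 6 * T (3 + i)"
      using ratio[of "3 + i"] mult_right_mono[OF _ T0] by (metis add_Suc_right order_trans)
    then show ?case
      using Suc by simp
  qed simp
  have "n choose k = (\<Sum>i\<le>k. (k choose i) * ((n - k) choose (k - i)))"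
    using vandermonde[of k "n - k" k] kn by simp
  then have "real (n choose k) = (\<Sum>i\<le>k. T i)"
    by (simp only: T_def of_nat_sum)
  \<comment> \<open>The range is extended beyond \<open>k\<close> so that three terms can be split
    off even for \<open>k < 3\<close>.\<close>
  also have "\<dots> \<le> (\<Sum>i<3 + k. T i)"
    using T0 by (intro sum_mono2) auto
  also have "\<dots> = (\<Sum>i<3. T i) + (\<Sum>i<k. T (3 + i))"
  proof -
    have "(\<Sum>i<m + k. T i) = (\<Sum>i<m. T i) + (\<Sum>i<k. T (m + i))" for m
      by (induction k) auto
    then show ?thesis .
  qed
  also have "(\<Sum>i<k. T (3 + i)) \<le> (\<Sum>i<k. T 3 * (1 / 6) ^ i)"
    using tail by (intro sum_mono) (simp add: power_divide)
  also have "\<dots> \<le> T 3 * (6 / 5)"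
    unfolding sum_distrib_left[symmetric] using T0[of 3]
    by (intro mult_left_mono) (auto simp: sum_gp_strict)
  finally have "real (n choose k) \<le> T 0 + (T 1 + T 2 + 6 / 5 * T 3)"
    by (simp add: eval_nat_numeral)
  also have "T 1 + T 2 + 6 / 5 * T 3 < T 0"
  proof -
    define b where "b = (real k - 1)\<^sup>2 / (q + 2)"
    \<comment> \<open>The constant \<open>4 / 5\<close> is \<open>6 / 5\<close> from the geometric
      tail times \<open>2 / 3\<close> from the bound on \<open>T 3\<close>.\<close>
    define c where "c = 4 / 5 * (real k - 2)\<^sup>2 / (q + 4)"
    have bc: "b \<ge> 0" "c \<ge> 0"
      using q0 by (auto simp: b_def c_def)
    have "T 0 > 0"
      using kn by (simp add: T_def)
    have "6 / 5 * T 3 \<le> 6 / 5 * (2 / 3 * (real k - 2)\<^sup>2 / (q + 4) * T 2)"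
      using T3 by (intro mult_left_mono) auto
    also have "\<dots> = c * T 2"
    proof -
      have "6 / 5 * (2 / 3 * x / y * z) = 4 / 5 * x / y * z" for x y z :: real
        by simp
      then show ?thesis
        by (simp only: c_def)
    qed
    finally have "T 1 + T 2 + 6 / 5 * T 3 \<le> T 1 + (1 + c) * T 2"
      by (simp add: algebra_simps)
    also have "\<dots> \<le> T 1 + (1 + c) * (b * T 1)"
      using T2 bc by (intro add_left_mono mult_left_mono) (auto simp: b_def)
    also have "\<dots> = (1 + b * (1 + c)) * T 1"
      by (simp add: algebra_simps)
    also have "\<dots> \<le> (1 + b * (1 + c)) * (2 * (real k)\<^sup>2 / q * T 0)"
      using T1 bc by (intro mult_left_mono) auto
    also have "\<dots> = (2 * (real k)\<^sup>2 / q * (1 + b * (1 + c))) * T 0"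
      by simp
    also have "\<dots> < 1 * T 0"
      using threshold_inequality[of "real k"] k \<open>T 0 > 0\<close>
      by (intro mult_strict_right_mono) (auto simp: b_def c_def q_def)
    finally show ?thesis by simp
  qed
  finally show ?thesis
    by (simp add: T_def)
qed

section \<open>Chip firing\<close>

text \<open>The record type admits infinite vertex sets and arbitrary sets as edges; this predicate
  excludes both.\<close>

definition simple_graph :: "'a sgraph \<Rightarrow> bool" where
  "simple_graph G \<longleftrightarrow> finite (verts G) \<and>
    (\<forall>e\<in>edges G. \<exists>u v. e = {u, v} \<and> u \<noteq> v \<and> u \<in> verts G \<and> v \<in> verts G)"

text \<open>The graph Laplacian of a firing script: firing each \<open>v\<close> \<open>f v\<close>
  times subtracts it from a divisor, a negative \<open>f v\<close> meaning reverse firing. The value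
  0 outside the graph keeps divisors divisors.\<close>

definition laplacian :: "'a sgraph \<Rightarrow> ('a \<Rightarrow> int) \<Rightarrow> 'a \<Rightarrow> int" where
  "laplacian G f v = (if v \<in> verts G then \<Sum>w\<in>neighbours G v. f v - f w else 0)"

definition edge_boundary :: "'a sgraph \<Rightarrow> 'a set \<Rightarrow> 'a set set" where
  "edge_boundary G U = {e \<in> edges G. \<exists>u w. e = {u, w} \<and> u \<in> U \<and> w \<notin> U}"

lemma neighbours_subset: "neighbours G v \<subseteq> verts G"
  by (auto simp: neighbours_def)

lemma neighbours_sym: "v \<in> verts G \<Longrightarrow> w \<in> neighbours G v \<Longrightarrow> v \<in> neighbours G w"
  by (auto simp: neighbours_def insert_commute)

lemma finite_neighbours: "simple_graph G \<Longrightarrow> finite (neighbours G v)"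
  by (metis simple_graph_def neighbours_subset finite_subset)

lemma not_in_neighbours: "simple_graph G \<Longrightarrow> v \<notin> neighbours G v"
  by (fastforce simp: simple_graph_def neighbours_def)

lemma simple_graph_edge: "simple_graph G \<Longrightarrow> {u, w} \<in> edges G \<Longrightarrow> u \<in> verts G \<and> w \<in> verts G \<and> u \<noteq> w"
  by (fastforce simp: simple_graph_def doubleton_eq_iff)

lemma finite_edges: "simple_graph G \<Longrightarrow> finite (edges G)"
  by (rule finite_subset[of _ "Pow (verts G)"]) (auto simp: simple_graph_def)

lemma laplacian_zero [simp]: "laplacian G (\<lambda>_. 0) = (\<lambda>_. 0)"
  by (auto simp: laplacian_def)

lemma laplacian_add: "laplacian G (\<lambda>v. f v + g v) w = laplacian G f w + laplacian G g w"
  by (simp add: laplacian_def sum.distrib[symmetric] algebra_simps)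

lemma laplacian_minus: "laplacian G (\<lambda>v. - f v) w = - laplacian G f w"
  by (simp add: laplacian_def sum_negf[symmetric])

text \<open>Constants lie in the kernel. This allows scripts to be shifted until they are
  nonnegative and, with \<open>c = 0\<close>, to be changed outside the graph.\<close>

lemma laplacian_cong_const:
  assumes "\<And>v. v \<in> verts G \<Longrightarrow> f v = g v + c"
  shows "laplacian G f = laplacian G g"
proof
  fix v
  show "laplacian G f v = laplacian G g v"
    using assms neighbours_subset[of G v] by (auto simp: laplacian_def intro!: sum.cong)
qed

text \<open>When a set \<open>U\<close> fires, chips between two of its members cancel: only the
  edges leaving \<open>U\<close> carry a chip.\<close>

lemma laplacian_indicator:
  assumes "simple_graph G" "v \<in> verts G"
  shows "laplacian G (\<lambda>u. of_bool (u \<in> U)) v =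
    (if v \<in> U then int (card (neighbours G v - U)) else - int (card (neighbours G v \<inter> U)))"
  using finite_neighbours[OF assms(1), of v] assms(2)
  by (auto simp: laplacian_def sum_negf sum_subtractf of_bool_def sum.If_cases
      card_Diff_subset_Int card_mono)

lemma fire_eq_laplacian:
  assumes "simple_graph G" "v \<in> verts G"
  shows "fire G v D = (\<lambda>w. D w - laplacian G (\<lambda>u. of_bool (u \<in> {v})) w)"
proof
  fix w
  have "neighbours G v - {v} = neighbours G v"
    using not_in_neighbours[OF assms(1), of v] by auto
  moreover have "neighbours G w \<inter> {v} = (if w \<in> neighbours G v then {v} else {})" if "w \<in> verts G"
    using neighbours_sym[OF that, of v] neighbours_sym[OF assms(2), of w] by auto
  moreover have "w \<notin> neighbours G v" if "w \<notin> verts G"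
    using that neighbours_subset[of G v] by auto
  ultimately show "fire G v D w = D w - laplacian G (\<lambda>u. of_bool (u \<in> {v})) w"
    using laplacian_indicator[OF assms(1), of w "{v}"] assms(2)
    by (cases "w \<in> verts G") (auto simp: fire_def laplacian_def)
qed

lemma firing_sequence_laplacian:
  assumes "simple_graph G" "firing_sequence G D D'"
  shows "\<exists>f. D' = (\<lambda>v. D v - laplacian G f v)"
  using assms(2) unfolding firing_sequence_def
proof (induction rule: rtranclp_induct)
  case base
  show ?case by (rule exI[of _ "\<lambda>_. 0"]) simp
next
  case (step D1 D2)
  then obtain f v where "D1 = (\<lambda>v. D v - laplacian G f v)" "v \<in> verts G" "D2 = fire G v D1"
    by blast
  then have "D2 = (\<lambda>w. D w - laplacian G (\<lambda>u. f u + of_bool (u \<in> {v})) w)"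
    using fire_eq_laplacian[OF assms(1)] by (simp add: laplacian_add algebra_simps)
  then show ?case by blast
qed

lemma div_equiv_laplacian:
  assumes "simple_graph G" "div_equiv G D D'"
  shows "\<exists>f. D' = (\<lambda>v. D v - laplacian G f v)"
  using assms(2) unfolding div_equiv_def
proof
  assume "firing_sequence G D' D"
  then obtain f where "D = (\<lambda>v. D' v - laplacian G f v)"
    using firing_sequence_laplacian[OF assms(1)] by blast
  then have "D' = (\<lambda>v. D v - laplacian G (\<lambda>v. - f v) v)"
    by (simp add: laplacian_minus)
  then show ?thesis by blast
qed (rule firing_sequence_laplacian[OF assms(1)])

text \<open>The differences \<open>f v - f w\<close> and \<open>f w - f v\<close> along each edge
  cancel. Hence firing preserves the degree.\<close>

lemma sum_laplacian:
  assumes "simple_graph G"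
  shows "(\<Sum>v\<in>verts G. laplacian G f v) = 0"
proof -
  define a where "a v w = of_bool (w \<in> neighbours G v) * (f v - f w)" for v w
  have fin: "finite (verts G)"
    using assms by (simp add: simple_graph_def)
  have "laplacian G f v = (\<Sum>w\<in>verts G. a v w)" if "v \<in> verts G" for v
    using that fin neighbours_subset[of G v]
    by (auto simp: laplacian_def a_def intro: sum.mono_neutral_cong_left)
  then have sum: "(\<Sum>v\<in>verts G. laplacian G f v) = (\<Sum>v\<in>verts G. \<Sum>w\<in>verts G. a v w)"
    by simp
  also have "\<dots> = (\<Sum>w\<in>verts G. \<Sum>v\<in>verts G. a v w)"
    by (rule sum.swap)
  also have "\<dots> = (\<Sum>w\<in>verts G. \<Sum>v\<in>verts G. - a w v)"
    by (intro sum.cong refl) (auto simp: a_def dest: neighbours_sym[rotated])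
  also have "\<dots> = - (\<Sum>v\<in>verts G. laplacian G f v)"
    by (simp add: sum sum_negf)
  finally show ?thesis by simp
qed

lemma deg_diff: "deg G (\<lambda>v. D v - E v) = deg G D - deg G E"
  by (simp add: deg_def sum_subtractf)

lemma deg_diff_laplacian: "simple_graph G \<Longrightarrow> deg G (\<lambda>v. D v - laplacian G f v) = deg G D"
  unfolding deg_diff by (simp add: deg_def sum_laplacian)

lemma deg_div_equiv: "simple_graph G \<Longrightarrow> div_equiv G D D' \<Longrightarrow> deg G D' = deg G D"
  using div_equiv_laplacian[of G D D'] by (auto simp: deg_diff_laplacian)

lemma firing_sequence_add:
  assumes "firing_sequence G D D'"
  shows "firing_sequence G (\<lambda>v. D v + E v) (\<lambda>v. D' v + E v)"
  using assms unfolding firing_sequence_def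
proof (induction rule: rtranclp_induct)
  case (step D1 D2)
  then obtain v where "v \<in> verts G" "D2 = fire G v D1"
    by blast
  then have "(\<lambda>w. D2 w + E w) = fire G v (\<lambda>w. D1 w + E w)"
    by (auto simp: fire_def)
  with \<open>v \<in> verts G\<close> show ?case
    by (intro rtranclp.rtrancl_into_rtrancl[OF step.IH] bexI)
qed simp

lemma div_equiv_add: "div_equiv G D D' \<Longrightarrow> div_equiv G (\<lambda>v. D v + E v) (\<lambda>v. D' v + E v)"
  unfolding div_equiv_def by (elim disjE) (simp_all add: firing_sequence_add)

lemma effective_add: "effective G D \<Longrightarrow> effective G E \<Longrightarrow> effective G (\<lambda>v. D v + E v)"
  by (auto simp: effective_def divisor_def)

lemma equiv_to_effective_add:
  assumes "equiv_to_effective G D" "effective G E"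
  shows "equiv_to_effective G (\<lambda>v. D v + E v)"
proof -
  obtain D' where "effective G D'" "div_equiv G D D'"
    using assms(1) by (auto simp: equiv_to_effective_def)
  then show ?thesis
    unfolding equiv_to_effective_def using assms(2)
    by (intro exI[of _ "\<lambda>v. D' v + E v"] conjI effective_add div_equiv_add)
qed

lemma deg_nonneg: "effective G D \<Longrightarrow> deg G D \<ge> 0"
  unfolding deg_def effective_def by (intro sum_nonneg) auto

lemma equiv_to_effective_deg: "simple_graph G \<Longrightarrow> equiv_to_effective G D \<Longrightarrow> deg G D \<ge> 0"
  unfolding equiv_to_effective_def by (metis deg_div_equiv deg_nonneg)

lemma equiv_to_effective_refl: "effective G D \<Longrightarrow> equiv_to_effective G D"
  unfolding equiv_to_effective_def div_equiv_def firing_sequence_def by blast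

section \<open>Rank at least one\<close>

text \<open>Above a witness \<open>a\<close> and below the bound \<open>b\<close> there are finitely
  many integers, so \<open>Greatest\<close> is a true maximum.\<close>

lemma Greatest_int_ex:
  fixes P :: "int \<Rightarrow> bool"
  assumes "P a" "\<And>x. P x \<Longrightarrow> x \<le> b"
  shows "P (Greatest P)" "P x \<Longrightarrow> x \<le> Greatest P"
proof -
  let ?S = "{x. P x \<and> a \<le> x}"
  have "finite ?S"
    by (rule finite_subset[of _ "{a..b}"]) (use assms in auto)
  moreover have "?S \<noteq> {}" using assms by auto
  ultimately have M: "Max ?S \<in> ?S" "\<And>x. x \<in> ?S \<Longrightarrow> x \<le> Max ?S"
    using Max_in[of ?S] Max_ge[of ?S] by blast+
  have ub: "x \<le> Max ?S" if "P x" for x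
    using M that by (cases "a \<le> x") force+
  then have eq: "Greatest P = Max ?S"
    using M(1) by (intro Greatest_equality) auto
  show "P (Greatest P)" "P x \<Longrightarrow> x \<le> Greatest P"
    using M(1) ub unfolding eq by auto
qed

text \<open>The predicate maximised in the definition of \<open>rk\<close>.\<close>

definition covers_degree :: "'a sgraph \<Rightarrow> ('a \<Rightarrow> int) \<Rightarrow> int \<Rightarrow> bool" where
  "covers_degree G D r \<longleftrightarrow> r \<ge> 0 \<and>
     (\<forall>E. effective G E \<and> deg G E = r \<longrightarrow> equiv_to_effective G (\<lambda>v. D v - E v))"

lemma effective_point: "c \<ge> 0 \<Longrightarrow> v \<in> verts G \<Longrightarrow> effective G (\<lambda>u. if u = v then c else 0)"
  by (auto simp: effective_def divisor_def)

lemma deg_point: "finite (verts G) \<Longrightarrow> v \<in> verts G \<Longrightarrow> deg G (\<lambda>u. if u = v then c else 0) = c"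
  by (simp add: deg_def)

text \<open>Subtracting \<open>r\<close> chips at a single vertex must leave a nonnegative degree.
  This bounds the set whose maximum is the rank.\<close>

lemma covers_degree_le:
  assumes "simple_graph G" "verts G \<noteq> {}" "covers_degree G D r"
  shows "r \<le> deg G D"
proof -
  obtain v where v: "v \<in> verts G" using assms by blast
  let ?E = "\<lambda>u. if u = v then r else 0"
  have "deg G ?E = r" "effective G ?E"
    using assms v by (auto simp: simple_graph_def covers_degree_def deg_point intro: effective_point)
  then have "0 \<le> deg G (\<lambda>v. D v - ?E v)"
    using assms equiv_to_effective_deg by (auto simp: covers_degree_def)
  also have "deg G (\<lambda>v. D v - ?E v) = deg G D - deg G ?E"
    by (rule deg_diff)
  finally show ?thesis
    using \<open>deg G ?E = r\<close> by simp
qed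

lemma rk_ge_1_iff:
  assumes G: "simple_graph G" "verts G \<noteq> {}"
  shows "rk G D \<ge> 1 \<longleftrightarrow> equiv_to_effective G D \<and>
    (\<forall>v\<in>verts G. equiv_to_effective G (\<lambda>u. D u - (if u = v then 1 else 0)))" (is "_ \<longleftrightarrow> ?R")
proof (cases "equiv_to_effective G D")
  case True
  have fin: "finite (verts G)"
    using G by (simp add: simple_graph_def)
  have rk: "rk G D = Greatest (covers_degree G D)"
    using True by (simp add: rk_def covers_degree_def[abs_def])
  have "E v = 0" if "effective G E" "deg G E = 0" for E v
    using that fin sum_nonneg_eq_0_iff[of "verts G" E] unfolding effective_def divisor_def deg_def by metis
  then have "(\<lambda>v. D v - E v) = D" if "effective G E" "deg G E = 0" for E
    using that by auto
  then have "covers_degree G D 0"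
    using True by (auto simp: covers_degree_def)
  note greatest = Greatest_int_ex[of "covers_degree G D", OF this covers_degree_le[OF G]]
  show ?thesis
  proof
    assume "1 \<le> rk G D"
    then have r: "covers_degree G D (rk G D)"
      using greatest(1) unfolding rk by blast
    have "equiv_to_effective G (\<lambda>u. D u - (if u = v then 1 else 0))" if v: "v \<in> verts G" for v
    proof -
      \<comment> \<open>All \<open>rk G D\<close> chips are removed at \<open>v\<close>, and all but
        one are then returned.\<close>
      let ?E = "\<lambda>u. if u = v then rk G D else 0"
      have "equiv_to_effective G (\<lambda>u. D u - ?E u)"
        using r effective_point[of "rk G D" v G] deg_point[OF fin v] v unfolding covers_degree_def by blast
      then have "equiv_to_effective G (\<lambda>u. D u - ?E u + (if u = v then rk G D - 1 else 0))"
        using v \<open>1 \<le> rk G D\<close> by (intro equiv_to_effective_add effective_point) auto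
      moreover have "(\<lambda>u. D u - ?E u + (if u = v then rk G D - 1 else 0)) = (\<lambda>u. D u - (if u = v then 1 else 0))"
        by auto
      ultimately show ?thesis by simp
    qed
    then show ?R using True by blast
  next
    assume R: ?R
    have "covers_degree G D 1"
      unfolding covers_degree_def
    proof (intro conjI allI impI)
      fix E assume E: "effective G E \<and> deg G E = 1"
      then have "(\<Sum>v\<in>verts G. E v) \<noteq> 0"
        by (simp add: deg_def)
      then obtain v where v: "v \<in> verts G" "E v \<noteq> 0"
        by (meson sum.neutral)
      have "E v \<ge> 0" "\<And>u. u \<in> verts G \<Longrightarrow> E u \<ge> 0"
        using E v by (auto simp: effective_def)
      have sum: "E v + (\<Sum>u\<in>verts G - {v}. E u) = 1"
        using E fin v by (simp add: deg_def sum.remove)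
      have rest: "(\<Sum>u\<in>verts G - {v}. E u) \<ge> 0"
        using E by (intro sum_nonneg) (auto simp: effective_def)
      then have "E v = 1" "(\<Sum>u\<in>verts G - {v}. E u) = 0"
        using sum \<open>E v \<ge> 0\<close> v by linarith+
      then have "\<forall>u\<in>verts G - {v}. E u = 0"
        using fin E by (subst (asm) sum_nonneg_eq_0_iff) (auto simp: effective_def)
      \<comment> \<open>An effective divisor of degree 1 is a single chip.\<close>
      then have "E = (\<lambda>u. if u = v then 1 else 0)"
        using E \<open>E v = 1\<close> by (auto simp: effective_def divisor_def fun_eq_iff)
      then show "equiv_to_effective G (\<lambda>v. D v - E v)"
        using R v by simp
    qed simp
    then show "1 \<le> rk G D"
      using greatest(2) rk by simp
  qed
qed (simp add: rk_def)

section \<open>Scramble number and gonality\<close>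

lemma edge_boundary_eq:
  assumes "simple_graph G"
  shows "edge_boundary G U = (\<Union>u\<in>U. (\<lambda>w. {u, w}) ` (neighbours G u - U))"
  using simple_graph_edge[OF assms] by (fastforce simp: edge_boundary_def neighbours_def)

text \<open>A boundary edge has exactly one end in \<open>U\<close>, so sorting the edges by this
  end gives a disjoint union.\<close>

lemma card_edge_boundary:
  assumes "simple_graph G" "U \<subseteq> verts G"
  shows "card (edge_boundary G U) = (\<Sum>u\<in>U. card (neighbours G u - U))"
proof -
  have "finite U"
    using assms finite_subset by (auto simp: simple_graph_def)
  then have "card (edge_boundary G U) = (\<Sum>u\<in>U. card ((\<lambda>w. {u, w}) ` (neighbours G u - U)))"
    unfolding edge_boundary_eq[OF assms(1)] using finite_neighbours[OF assms(1)]
    by (intro card_UN_disjoint) (auto simp: doubleton_eq_iff)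
  also have "\<dots> = (\<Sum>u\<in>U. card (neighbours G u - U))"
    by (intro sum.cong refl card_image) (auto simp: inj_on_def doubleton_eq_iff)
  finally show ?thesis .
qed

text \<open>A path inside the egg from a vertex of \<open>U\<close> to one outside has to leave
  \<open>U\<close> somewhere.\<close>

lemma egg_crossing_edge:
  assumes "egg G X" "X \<inter> U \<noteq> {}" "\<not> X \<subseteq> U"
  shows "\<exists>u\<in>X \<inter> U. \<exists>w\<in>X - U. {u, w} \<in> edges G"
proof (rule ccontr)
  assume no: "\<not> ?thesis"
  obtain x y where xy: "x \<in> X" "x \<in> U" "y \<in> X" "y \<notin> U"
    using assms by blast
  then have "reachable (induced_subgraph G X) x y"
    using assms(1) by (auto simp: egg_def connected_graph_def induced_subgraph_def)
  then have "y \<in> U"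
    unfolding reachable_def
    by (induction rule: rtranclp_induct) (use xy no in \<open>auto simp: induced_subgraph_def\<close>)
  with xy show False by simp
qed

text \<open>No edge inside such an egg crosses the boundary of \<open>U\<close>, so the egg stays
  connected after the deletion.\<close>

lemma egg_in_component:
  assumes "egg G X" "X \<subseteq> U \<or> X \<inter> U = {}" "x \<in> X"
  shows "X \<subseteq> {v \<in> verts G. reachable (delete_edges G (edge_boundary G U)) x v}"
proof
  fix v assume v: "v \<in> X"
  then have "reachable (induced_subgraph G X) x v"
    using assms by (auto simp: egg_def connected_graph_def induced_subgraph_def)
  then have "reachable (delete_edges G (edge_boundary G U)) x v"
    unfolding reachable_def
    by (rule rtranclp_mono[THEN predicate2D, rotated])
      (use assms(2) in \<open>auto simp: induced_subgraph_def delete_edges_def edge_boundary_def doubleton_eq_iff\<close>)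
  then show "v \<in> {v \<in> verts G. reachable (delete_edges G (edge_boundary G U)) x v}"
    using v assms(1) by (auto simp: egg_def)
qed

lemma reachable_delete_boundary:
  assumes "simple_graph G" "reachable (delete_edges G (edge_boundary G U)) x v" "x \<in> U"
  shows "v \<in> U"
  using assms(2) unfolding reachable_def
  by (induction rule: rtranclp_induct) (use assms(3) in \<open>auto simp: delete_edges_def edge_boundary_def\<close>)

lemma egg_cut_edge_boundary:
  assumes G: "simple_graph G" and S: "scramble G S" "X \<in> S" "Y \<in> S"
    and U: "X \<subseteq> U" "Y \<inter> U = {}"
  shows "egg_cut G S (edge_boundary G U)"
proof -
  define comp where "comp x = {v \<in> verts G. reachable (delete_edges G (edge_boundary G U)) x v}" for x
  have eggs: "egg G X" "egg G Y"
    using S by (auto simp: scramble_def)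
  then obtain x y where xy: "x \<in> X" "y \<in> Y" "x \<in> verts G" "y \<in> verts G"
    by (auto simp: egg_def)
  have "comp x \<in> components (delete_edges G (edge_boundary G U))"
       "comp y \<in> components (delete_edges G (edge_boundary G U))"
    using xy by (auto simp: components_def comp_def delete_edges_def)
  moreover have "X \<subseteq> comp x" "Y \<subseteq> comp y"
    using egg_in_component[OF eggs(1) _ xy(1)] egg_in_component[OF eggs(2) _ xy(2)] U
    by (auto simp: comp_def)
  moreover have "comp x \<subseteq> U"
    using reachable_delete_boundary[OF G] xy U by (auto simp: comp_def)
  then have "comp x \<noteq> comp y"
    using \<open>Y \<subseteq> comp y\<close> U(2) xy(2) by blast
  moreover have "edge_boundary G U \<subseteq> edges G"
    by (auto simp: edge_boundary_def)
  ultimately show ?thesis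
    using S(2,3) unfolding egg_cut_def by blast
qed

text \<open>Vertices of \<open>U\<close> never gain chips and the others never lose any. If an edge
  inside the egg crossed from \<open>U\<close> to its complement, its outer end would hold a chip
  after the firing, and its inner end must have held one before. The first contradicts an egg
  emptied by the firing, the second an egg empty before it.\<close>

lemma subset_firing_egg:
  assumes G: "simple_graph G" "egg G X"
    and D: "effective G D" "effective G D'" "D' = (\<lambda>v. D v - laplacian G (\<lambda>u. of_bool (u \<in> U)) v)"
  shows "\<exists>v\<in>X. D v > 0 \<Longrightarrow> \<forall>v\<in>X. D' v = 0 \<Longrightarrow> X \<subseteq> U"
    and "\<forall>v\<in>X. D v = 0 \<Longrightarrow> \<exists>v\<in>X. D' v > 0 \<Longrightarrow> X \<inter> U = {}"
proof -
  have X: "X \<subseteq> verts G"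
    using G by (simp add: egg_def)
  have "D' v = (if v \<in> U then D v - int (card (neighbours G v - U)) else D v + int (card (neighbours G v \<inter> U)))"
    if "v \<in> X" for v
    using laplacian_indicator[OF G(1), of v U] X that by (auto simp: D(3))
  note D' = this
  have D0: "D v \<ge> 0" "D' v \<ge> 0" if "v \<in> X" for v
    using D(1,2) X that by (auto simp: effective_def)
  have nonempty: "card (neighbours G u - U) > 0" "card (neighbours G w \<inter> U) > 0"
    if "u \<in> X \<inter> U" "w \<in> X - U" "{u, w} \<in> edges G" for u w
    using that X finite_neighbours[OF G(1), of u] finite_neighbours[OF G(1), of w]
    by (auto simp: card_gt_0_iff neighbours_def insert_commute)
  {
    assume D1: "\<exists>v\<in>X. D v > 0" and D2: "\<forall>v\<in>X. D' v = 0"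
    then obtain v where v: "v \<in> X" "D v > 0" by blast
    then have "v \<in> U"
      using D'[of v] D2 by (auto split: if_splits)
    show "X \<subseteq> U"
    proof (rule ccontr)
      assume "\<not> X \<subseteq> U"
      with \<open>v \<in> U\<close> v(1) obtain u w where uw: "u \<in> X \<inter> U" "w \<in> X - U" "{u, w} \<in> edges G"
        using egg_crossing_edge[OF G(2), of U] by blast
      then show False
        using D'[of w] D2 nonempty(2)[OF uw] D0(1)[of w] by (auto simp: add_nonneg_eq_0_iff)
    qed
  next
    assume D1: "\<forall>v\<in>X. D v = 0" and D2: "\<exists>v\<in>X. D' v > 0"
    then obtain v where v: "v \<in> X" "D' v > 0" by blast
    then have "v \<notin> U"
      using D'[of v] D1 by (auto split: if_splits)
    show "X \<inter> U = {}"
    proof (rule ccontr)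
      assume "X \<inter> U \<noteq> {}"
      with \<open>v \<notin> U\<close> v(1) obtain u w where uw: "u \<in> X \<inter> U" "w \<in> X - U" "{u, w} \<in> edges G"
        using egg_crossing_edge[OF G(2), of U] by blast
      then show False
        using D'[of u] D1 nonempty(1)[OF uw] D0(2)[of u] by auto
    qed
  }
qed

text \<open>To stay out of debt, each vertex of \<open>U\<close> must hold a chip for every edge on
  which it sends one out.\<close>

lemma card_edge_boundary_le_deg:
  assumes G: "simple_graph G" "U \<subseteq> verts G"
    and D: "effective G D" "effective G (\<lambda>v. D v - laplacian G (\<lambda>u. of_bool (u \<in> U)) v)"
  shows "int (card (edge_boundary G U)) \<le> deg G D"
proof -
  have fin: "finite (verts G)"
    using G by (simp add: simple_graph_def)
  have "int (card (edge_boundary G U)) = (\<Sum>u\<in>U. int (card (neighbours G u - U)))"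
    using card_edge_boundary[OF G] by simp
  also have "\<dots> \<le> (\<Sum>u\<in>U. D u)"
    using D(2) laplacian_indicator[OF G(1), of _ U] G(2) by (intro sum_mono) (fastforce simp: effective_def)
  also have "\<dots> \<le> deg G D"
    unfolding deg_def using D(1) G(2) fin by (intro sum_mono2) (auto simp: effective_def)
  finally show ?thesis .
qed

section \<open>Firing along superlevel sets\<close>

text \<open>Natural subtraction cuts the script off at 0. A vertex with \<open>f v \<le> c\<close>
  does not fire and can only gain; any other vertex loses at most what it loses under the full
  script.\<close>

lemma effective_truncated_firing:
  fixes f :: "'a \<Rightarrow> nat"
  assumes "effective G D" "effective G (\<lambda>v. D v - laplacian G (\<lambda>u. int (f u)) v)"
  shows "effective G (\<lambda>v. D v - laplacian G (\<lambda>u. int (f u - c)) v)"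
  unfolding effective_def
proof (intro conjI ballI)
  show "divisor G (\<lambda>v. D v - laplacian G (\<lambda>u. int (f u - c)) v)"
    using assms(1) by (simp add: effective_def divisor_def laplacian_def)
next
  fix v assume v: "v \<in> verts G"
  show "0 \<le> D v - laplacian G (\<lambda>u. int (f u - c)) v"
  proof (cases "f v \<le> c")
    case True
    then have "laplacian G (\<lambda>u. int (f u - c)) v \<le> 0"
      by (auto simp: laplacian_def intro: sum_nonpos)
    then show ?thesis
      using assms(1) v by (force simp: effective_def)
  next
    case False
    then have "laplacian G (\<lambda>u. int (f u - c)) v \<le> laplacian G (\<lambda>u. int (f u)) v"
      by (auto simp: laplacian_def intro: sum_mono)
    then show ?thesis
      using assms(2) v by (force simp: effective_def)
  qed
qed

text \<open>Lowering the threshold from \<open>Suc c\<close> to \<open>c\<close> adds one firing of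
  the superlevel set of \<open>c\<close>.\<close>

lemma truncated_firing_step:
  "laplacian G (\<lambda>u. int (f u - c)) v =
   laplacian G (\<lambda>u. int (f u - Suc c)) v + laplacian G (\<lambda>u. of_bool (u \<in> {u \<in> verts G. c < f u})) v"
  unfolding laplacian_add[symmetric]
  by (rule laplacian_cong_const[of G _ _ 0, THEN fun_cong]) (auto simp: of_bool_def)

lemma nat_last_switch:
  fixes a b :: nat
  assumes "\<not> P a" "P b" "a \<le> b"
  shows "\<exists>c\<ge>a. c < b \<and> \<not> P c \<and> P (Suc c)"
  using assms(3,2)
proof (induction b rule: dec_induct)
  case base
  with assms(1) show ?case by simp
next
  case (step m)
  then show ?case by (cases "P m") (auto intro: less_SucI)
qed

text \<open>Among the effective divisors equivalent to \<open>D\<close> take one meeting as many eggs as possible.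
  If it misses an egg \<open>Y\<close>, fire it towards a divisor meeting \<open>Y\<close> through the increasing chain of superlevel
  sets of the firing function. Before (or when) \<open>Y\<close> is met, an egg \<open>X\<close> met at the start is lost, and
  the superlevel set fired when \<open>X\<close> is lost separates \<open>X\<close> from \<open>Y\<close>.\<close>

theorem scramble_order_le_deg:
  assumes G: "simple_graph G" and S: "scramble G S" and D: "rk G D \<ge> 1" and V: "verts G \<noteq> {}"
  shows "scramble_order G S \<le> enat (nat (deg G D))"
proof -
  define \<D> where "\<D> = {D'. effective G D' \<and> (\<exists>f. D' = (\<lambda>v. D v - laplacian G f v))}"
  define met where "met D' = {X \<in> S. \<exists>v\<in>X. D' v > 0}" for D' :: "'a \<Rightarrow> int"
  have fin: "finite (verts G)" "finite S"
    using G S by (auto simp: simple_graph_def scramble_def)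
  have eggs: "egg G X" if "X \<in> S" for X
    using S that by (simp add: scramble_def)
  have finmet: "finite (met D')" for D'
    using fin by (simp add: met_def)
  have degD: "deg G D' = deg G D" if "D' \<in> \<D>" for D'
    using that deg_diff_laplacian[OF G] by (auto simp: \<D>_def)
  have covers: "\<exists>D'\<in>\<D>. D' v \<ge> 1" if v: "v \<in> verts G" for v
  proof -
    obtain D1 where D1: "effective G D1" "div_equiv G (\<lambda>u. D u - (if u = v then 1 else 0)) D1"
      using D v unfolding rk_ge_1_iff[OF G V] equiv_to_effective_def by blast
    then obtain f where f: "D1 = (\<lambda>u. D u - (if u = v then 1 else 0) - laplacian G f u)"
      using div_equiv_laplacian[OF G] by blast
    \<comment> \<open>Returning the chip at \<open>v\<close> gives an effective divisor in the class
      of \<open>D\<close> with a chip on \<open>v\<close>.\<close>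
    define D2 where "D2 u = D1 u + (if u = v then 1 else 0)" for u
    have "effective G D2"
      unfolding D2_def using D1(1) v by (intro effective_add effective_point) auto
    moreover have "D2 = (\<lambda>u. D u - laplacian G f u)"
      by (auto simp: D2_def f)
    moreover have "D2 v \<ge> 1"
      using D1(1) v by (simp add: D2_def effective_def)
    ultimately show ?thesis
      by (auto simp: \<D>_def)
  qed
  obtain v where "v \<in> verts G"
    using V by blast
  then obtain D2 where "D2 \<in> \<D>"
    using covers by blast
  moreover have "\<forall>D'. D' \<in> \<D> \<longrightarrow> card (met D') < Suc (card S)"
    using fin by (auto simp: met_def less_Suc_eq_le intro: card_mono)
  ultimately obtain D0 where D0: "D0 \<in> \<D>" "\<And>D'. D' \<in> \<D> \<Longrightarrow> card (met D') \<le> card (met D0)"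
    using ex_has_greatest_nat[of "\<lambda>D'. D' \<in> \<D>" D2 "\<lambda>D'. card (met D')" "Suc (card S)"] by auto
  have eff0: "effective G D0"
    using D0 by (simp add: \<D>_def)
  show ?thesis
  proof (cases "met D0 = S")
    case True
    \<comment> \<open>When every egg is met, the support of \<open>D0\<close> is a hitting set, of
      size at most the degree.\<close>
    define H where "H = {v \<in> verts G. D0 v > 0}"
    have "hitting_set G S H"
      using True eggs unfolding hitting_set_def H_def met_def egg_def by blast
    then have "hitting_number G S \<le> card H"
      unfolding hitting_number_def by (intro Least_le) blast
    also have "int (card H) = (\<Sum>v\<in>H. 1)"
      by simp
    also have "\<dots> \<le> (\<Sum>v\<in>H. D0 v)"
      by (intro sum_mono) (auto simp: H_def)
    also have "\<dots> \<le> deg G D0"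
      unfolding deg_def using fin eff0 by (intro sum_mono2) (auto simp: H_def effective_def)
    finally have "hitting_number G S \<le> nat (deg G D)"
      using degD[OF D0(1)] by arith
    then show ?thesis
      unfolding scramble_order_def by (simp add: min_le_iff_disj)
  next
    case False
    then obtain Y where Y: "Y \<in> S" "Y \<notin> met D0"
      by (auto simp: met_def)
    obtain y where y: "y \<in> Y" "y \<in> verts G"
      using eggs[OF Y(1)] by (auto simp: egg_def)
    obtain D1 where D1: "D1 \<in> \<D>" "D1 y \<ge> 1"
      using covers[OF y(2)] by blast
    obtain f0 f1 where f: "D0 = (\<lambda>v. D v - laplacian G f0 v)" "D1 = (\<lambda>v. D v - laplacian G f1 v)"
      using D0 D1 by (auto simp: \<D>_def)
    define g where "g v = f1 v - f0 v" for v
    define m where "m = Min (g ` verts G)"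
    define h where "h v = nat (g v - m)" for v
    \<comment> \<open>Firing lowers the index: the chain runs from \<open>E M = D0\<close> down to
      \<open>E 0 = D1\<close>, and \<open>E (Suc c)\<close> becomes \<open>E c\<close> by firing
      \<open>U c\<close>.\<close>
    define E where "E c = (\<lambda>v. D0 v - laplacian G (\<lambda>u. int (h u - c)) v)" for c
    have "int (h v) = g v - m" if "v \<in> verts G" for v
      using fin that by (auto simp: h_def m_def intro: Min_le)
    then have "laplacian G (\<lambda>u. int (h u)) = laplacian G g"
      by (intro laplacian_cong_const[of G _ _ "- m"]) auto
    moreover have "laplacian G g v = laplacian G f1 v - laplacian G f0 v" for v
      using laplacian_add[of G g f0 v] by (simp add: g_def)
    ultimately have E0: "E 0 = D1"
      by (auto simp: E_def f)
    define M where "M = Max (h ` verts G)"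
    have "h v \<le> M" if "v \<in> verts G" for v
      using fin that by (auto simp: M_def)
    then have "laplacian G (\<lambda>u. int (h u - M)) = laplacian G (\<lambda>_. 0)"
      by (intro laplacian_cong_const[of G _ _ 0]) auto
    then have EM: "E M = D0"
      by (simp add: E_def)
    have eff: "effective G (E c)" for c
      unfolding E_def using eff0 E0 D1(1)
      by (intro effective_truncated_firing) (auto simp: E_def \<D>_def)
    have E\<D>: "E c \<in> \<D>" for c
    proof -
      have "E c = (\<lambda>v. D v - laplacian G (\<lambda>u. f0 u + int (h u - c)) v)"
        by (auto simp: E_def f laplacian_add)
      then show ?thesis
        unfolding \<D>_def using eff[of c] by blast
    qed
    define U where "U c = {u \<in> verts G. c < h u}" for c
    have step: "E c = (\<lambda>v. E (Suc c) v - laplacian G (\<lambda>u. of_bool (u \<in> U c)) v)" for c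
      unfolding E_def U_def by (subst truncated_firing_step) auto
    have zero: "\<forall>v\<in>X. E c v = 0" if "X \<in> S" "X \<notin> met (E c)" for X c
      using that eff[of c] eggs[OF that(1)] by (force simp: met_def effective_def egg_def)
    have "Y \<in> met (E 0)"
      using Y(1) y D1(2) by (auto simp: met_def E0 intro!: bexI[of _ y])
    \<comment> \<open>Firing \<open>U c\<close> puts a chip on the egg \<open>Y\<close>, which had
      none.\<close>
    then obtain c where c: "c < M" "Y \<in> met (E c)" "Y \<notin> met (E (Suc c))"
      using nat_last_switch[of "\<lambda>c. Y \<notin> met (E c)" 0 M] Y(2) by (auto simp: EM)
    \<comment> \<open>\<open>E c\<close> meets \<open>Y\<close> while \<open>D0\<close> does not, so
      by maximality some egg met by \<open>D0\<close> has been lost.\<close>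
    have "\<not> met D0 \<subseteq> met (E c)"
    proof
      assume "met D0 \<subseteq> met (E c)"
      then have "met D0 \<subset> met (E c)"
        using c(2) Y(2) by blast
      then have "card (met D0) < card (met (E c))"
        using finmet psubset_card_mono by blast
      with D0(2)[OF E\<D>[of c]] show False by simp
    qed
    then obtain X where X: "X \<in> S" "X \<in> met (E M)" "X \<notin> met (E c)"
      by (auto simp: EM met_def)
    then obtain d where d: "c \<le> d" "X \<notin> met (E d)" "X \<in> met (E (Suc d))"
      using nat_last_switch[of "\<lambda>c. X \<in> met (E c)" c M, OF X(3,2) less_imp_le[OF c(1)]] by blast
    have "\<exists>v\<in>X. E (Suc d) v > 0"
      using d(3) by (simp add: met_def)
    then have "X \<subseteq> U d"
      using zero[OF X(1) d(2)] by (rule subset_firing_egg(1)[OF G eggs[OF X(1)] eff eff step])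
    have "\<exists>v\<in>Y. E c v > 0"
      using c(2) by (simp add: met_def)
    with zero[OF Y(1) c(3)] have "Y \<inter> U c = {}"
      by (rule subset_firing_egg(2)[OF G eggs[OF Y(1)] eff eff step])
    \<comment> \<open>The superlevel sets decrease in the index, so \<open>c \<le> d\<close> gives
      \<open>U d \<subseteq> U c\<close>.\<close>
    then have "Y \<inter> U d = {}"
      using d(1) by (auto simp: U_def)
    with \<open>X \<subseteq> U d\<close> have "egg_cut G S (edge_boundary G (U d))"
      by (intro egg_cut_edge_boundary[OF G S X(1) Y(1)])
    then have "egg_cut_number G S \<le> enat (card (edge_boundary G (U d)))"
      unfolding egg_cut_number_def by (intro Inf_lower) blast
    moreover have "int (card (edge_boundary G (U d))) \<le> deg G (E (Suc d))"
      using eff[of d] unfolding step[of d] by (intro card_edge_boundary_le_deg[OF G _ eff]) (auto simp: U_def)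
    then have "enat (card (edge_boundary G (U d))) \<le> enat (nat (deg G D))"
      using degD[OF E\<D>] by simp
    ultimately show ?thesis
      unfolding scramble_order_def by (meson min.coboundedI2 order_trans)
  qed
qed

section \<open>The scramble of all edges\<close>

definition independent_set :: "'a sgraph \<Rightarrow> 'a set \<Rightarrow> bool" where
  "independent_set G I \<longleftrightarrow> I \<subseteq> verts G \<and> (\<forall>u\<in>I. \<forall>v\<in>I. {u, v} \<notin> edges G)"

lemma scramble_edges:
  assumes "simple_graph G"
  shows "scramble G (edges G)"
  unfolding scramble_def
proof (intro conjI ballI)
  fix e assume e: "e \<in> edges G"
  then obtain u v where uv: "e = {u, v}" "u \<in> verts G" "v \<in> verts G"
    using assms by (auto simp: simple_graph_def)
  have "reachable (induced_subgraph G e) a b" if "a \<in> e" "b \<in> e" for a b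
  proof (cases "a = b")
    case False
    with that uv have "{a, b} = e" by auto
    with e show ?thesis
      by (auto simp: reachable_def induced_subgraph_def)
  qed (simp add: reachable_def)
  with uv show "egg G e"
    by (auto simp: egg_def connected_graph_def induced_subgraph_def)
qed (rule finite_edges[OF assms])

text \<open>With \<open>s = card U\<close>, the bound \<open>s * (d - s + 1)\<close> is concave in
  \<open>s\<close> and equals \<open>2 * (d - 1)\<close> at both \<open>s = 2\<close> and
  \<open>s = d - 1\<close>. The hypotheses place \<open>s\<close> between these values.\<close>

lemma card_edge_boundary_ge:
  assumes G: "simple_graph G" and U: "U \<subseteq> verts G" "2 \<le> card U" "2 * card U \<le> card (verts G)"
    and d: "\<And>v. v \<in> verts G \<Longrightarrow> d \<le> card (neighbours G v)" "card (verts G) < 2 * d"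
  shows "card (verts G) - 1 \<le> card (edge_boundary G U)"
proof -
  have fin: "finite U"
    using U(1) G finite_subset by (auto simp: simple_graph_def)
  have deg: "d - (card U - 1) \<le> card (neighbours G u - U)" if "u \<in> U" for u
  proof -
    have "card (neighbours G u \<inter> U) \<le> card (U - {u})"
      using fin not_in_neighbours[OF G, of u] by (intro card_mono) auto
    also have "\<dots> = card U - 1"
      using that by simp
    finally have "card (neighbours G u \<inter> U) \<le> card U - 1" .
    moreover have "card (neighbours G u - U) = card (neighbours G u) - card (neighbours G u \<inter> U)"
      using finite_neighbours[OF G] by (simp add: card_Diff_subset_Int)
    moreover have "d \<le> card (neighbours G u)"
      using d(1) that U(1) by blast
    ultimately show ?thesis by linarith
  qed
  \<comment> \<open>The parameters \<open>s\<close> and \<open>t\<close> remove truncated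
    subtraction; the inequality then has slack \<open>s * t\<close>.\<close>
  obtain s where s: "card U = 2 + s"
    using U(2) le_Suc_ex by blast
  obtain t where t: "d = card U + 1 + t"
    using U(3) d(2) less_imp_Suc_add[of "card U" d] by auto
  have "card (verts G) - 1 \<le> 2 * (d - 1)"
    using d(2) by simp
  also have "\<dots> \<le> card U * (d - (card U - 1))"
    unfolding t s by (simp add: algebra_simps)
  also have "\<dots> \<le> (\<Sum>u\<in>U. card (neighbours G u - U))"
    using sum_bounded_below[of U "d - (card U - 1)"] deg by simp
  finally show ?thesis
    by (simp add: card_edge_boundary[OF G U(1)])
qed

lemma reachable_sym: "reachable G u v \<Longrightarrow> reachable G v u"
  unfolding reachable_def by (rule sympD[OF symp_rtranclp]) (auto intro: sympI simp: insert_commute)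

lemma reachable_trans: "reachable G u v \<Longrightarrow> reachable G v w \<Longrightarrow> reachable G u w"
  unfolding reachable_def by (rule rtranclp_trans)

lemma components_disjoint:
  assumes "A \<in> components G" "B \<in> components G" "A \<noteq> B"
  shows "A \<inter> B = {}"
  using assms unfolding components_def by (blast intro: reachable_sym reachable_trans)

text \<open>A surviving edge out of the component would put its other end into the
  component.\<close>

lemma edge_boundary_component:
  assumes "simple_graph G" "A \<in> components (delete_edges G C)"
  shows "edge_boundary G A \<subseteq> C"
proof
  fix e assume "e \<in> edge_boundary G A"
  then obtain u w where e: "e \<in> edges G" "e = {u, w}" "u \<in> A" "w \<notin> A"
    by (auto simp: edge_boundary_def)
  then have "\<not> reachable (delete_edges G C) u w"
    using assms simple_graph_edge[OF assms(1), of u w]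
    by (auto simp: components_def delete_edges_def intro: reachable_trans)
  then show "e \<in> C"
    using e by (auto simp: reachable_def delete_edges_def)
qed

text \<open>Two components containing eggs are disjoint with at least two vertices each, and one of
  them has at most half of all vertices.\<close>

lemma card_egg_cut_edges_ge:
  assumes G: "simple_graph G" and C: "egg_cut G (edges G) C"
    and d: "\<And>v. v \<in> verts G \<Longrightarrow> d \<le> card (neighbours G v)" "card (verts G) < 2 * d"
  shows "card (verts G) - 1 \<le> card C"
proof -
  obtain A B where AB: "A \<in> components (delete_edges G C)" "B \<in> components (delete_edges G C)" "A \<noteq> B"
      "\<exists>X\<in>edges G. X \<subseteq> A" "\<exists>X\<in>edges G. X \<subseteq> B" and C: "C \<subseteq> edges G"
    using C by (auto simp: egg_cut_def)
  have fin: "finite (verts G)"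
    using G by (simp add: simple_graph_def)
  have "finite C"
    using C finite_edges[OF G] finite_subset by blast
  have sub: "A' \<subseteq> verts G" if "A' \<in> components (delete_edges G C)" for A'
    using that by (auto simp: components_def delete_edges_def)
  have large: "2 \<le> card A'" if A': "A' \<in> components (delete_edges G C)" "\<exists>X\<in>edges G. X \<subseteq> A'" for A'
  proof -
    obtain X where X: "X \<in> edges G" "X \<subseteq> A'" using A'(2) by blast
    then have "card X = 2"
      using G by (fastforce simp: simple_graph_def)
    then show ?thesis
      using card_mono[OF finite_subset[OF sub[OF A'(1)] fin] X(2)] by simp
  qed
  have bound: ?thesis if "A' \<in> components (delete_edges G C)" "\<exists>X\<in>edges G. X \<subseteq> A'"
    "2 * card A' \<le> card (verts G)" for A'
  proof -
    have "card (verts G) - 1 \<le> card (edge_boundary G A')"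
      using that by (intro card_edge_boundary_ge[OF G sub large _ d]) auto
    also have "\<dots> \<le> card C"
      using edge_boundary_component[OF G that(1)] \<open>finite C\<close> by (intro card_mono)
    finally show ?thesis .
  qed
  have "card A + card B = card (A \<union> B)"
    using components_disjoint[OF AB(1-3)] sub[OF AB(1)] sub[OF AB(2)] fin
    by (metis card_Un_disjoint finite_subset)
  also have "\<dots> \<le> card (verts G)"
    using sub AB fin by (intro card_mono) auto
  finally have "2 * card A \<le> card (verts G) \<or> 2 * card B \<le> card (verts G)"
    by linarith
  then show ?thesis
    using bound AB by blast
qed

text \<open>A set meets every edge exactly when its complement is independent. For egg-cuts,
  \<open>1 \<le> a\<close> weakens the bound \<open>card (verts G) - 1\<close> to the one
  claimed.\<close>

lemma scramble_order_edges_ge: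
  assumes G: "simple_graph G" and indep: "\<And>F. independent_set G F \<Longrightarrow> card F \<le> a" and "1 \<le> a"
    and d: "\<And>v. v \<in> verts G \<Longrightarrow> d \<le> card (neighbours G v)" "card (verts G) < 2 * d"
  shows "enat (card (verts G) - a) \<le> scramble_order G (edges G)"
proof -
  have hit: "card (verts G) - a \<le> card H" if H: "hitting_set G (edges G) H" for H
  proof -
    have "independent_set G (verts G - H)"
      using H by (auto simp: independent_set_def hitting_set_def)
    then have "card (verts G - H) \<le> a"
      by (rule indep)
    moreover have "card (verts G - H) = card (verts G) - card H"
      using H G by (metis card_Diff_subset finite_subset hitting_set_def simple_graph_def)
    ultimately show ?thesis by simp
  qed
  have "hitting_set G (edges G) (verts G)"
    using G by (fastforce simp: hitting_set_def simple_graph_def)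
  then have "\<exists>H. hitting_set G (edges G) H \<and> card H = hitting_number G (edges G)"
    unfolding hitting_number_def by (rule_tac LeastI_ex) blast
  then have "enat (card (verts G) - a) \<le> enat (hitting_number G (edges G))"
    using hit by (metis enat_ord_simps(1))
  moreover have "enat (card (verts G) - a) \<le> egg_cut_number G (edges G)"
    unfolding egg_cut_number_def
    using card_egg_cut_edges_ge[OF G _ d] \<open>1 \<le> a\<close> by (intro Inf_greatest) fastforce
  ultimately show ?thesis
    by (simp add: scramble_order_def)
qed

text \<open>Firing everything but \<open>v \<in> I\<close>, i.e. unfiring \<open>v\<close>, moves a chip from each neighbour to \<open>v\<close>.\<close>

lemma rk_complement_independent_set:
  assumes G: "simple_graph G" and I: "independent_set G I" "I \<noteq> {}"
    and nbr: "\<And>v. v \<in> I \<Longrightarrow> neighbours G v \<noteq> {}"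
  shows "rk G (\<lambda>v. of_bool (v \<in> verts G - I)) \<ge> 1"
proof -
  define D :: "'a \<Rightarrow> int" where "D v = of_bool (v \<in> verts G - I)" for v
  have "verts G \<noteq> {}"
    using I by (auto simp: independent_set_def)
  moreover have "equiv_to_effective G D"
    by (intro equiv_to_effective_refl) (auto simp: effective_def divisor_def D_def)
  moreover have "equiv_to_effective G (\<lambda>u. D u - (if u = v then 1 else 0))" if v: "v \<in> verts G" for v
  proof (cases "v \<in> I")
    case False
    then show ?thesis
      using v by (intro equiv_to_effective_refl) (auto simp: effective_def divisor_def D_def)
  next
    case True
    \<comment> \<open>Each neighbour of \<open>v\<close> holds one chip, since \<open>I\<close> is
      independent, and sends it to \<open>v\<close>; one of these chips pays the debt at
      \<open>v\<close>. Firing \<open>v\<close> leads back, so the equivalence is read in the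
      reverse direction.\<close>
    define D' where "D' u = (if u = v then int (card (neighbours G v)) - 1
        else if u \<in> neighbours G v then 0 else D u)" for u
    have "card (neighbours G v) > 0"
      using nbr[OF True] finite_neighbours[OF G] by (simp add: card_gt_0_iff)
    then have "effective G D'"
      using v neighbours_subset[of G v] by (auto simp: effective_def divisor_def D'_def D_def)
    moreover have "neighbours G v \<subseteq> verts G - I"
      using True I by (auto simp: independent_set_def neighbours_def)
    then have "(\<lambda>u. D u - (if u = v then 1 else 0)) = fire G v D'"
      using True not_in_neighbours[OF G, of v] by (auto simp: fire_def D'_def D_def fun_eq_iff)
    then have "firing_sequence G D' (\<lambda>u. D u - (if u = v then 1 else 0))"
      unfolding firing_sequence_def using v by blast
    ultimately show ?thesis
      unfolding equiv_to_effective_def div_equiv_def by blast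
  qed
  ultimately show ?thesis
    using rk_ge_1_iff[OF G] by (simp add: D_def[abs_def])
qed

text \<open>The edge scramble has order at least \<open>m\<close>, the divisor \<open>D\<close> has
  degree \<open>m\<close>, and no scramble order exceeds the degree of a divisor of rank at least
  1.\<close>

theorem sn_gon_eq_card_diff_independent:
  assumes G: "simple_graph G"
    and I: "independent_set G I" "I \<noteq> {}" "\<And>F. independent_set G F \<Longrightarrow> card F \<le> card I"
    and d: "\<And>v. v \<in> verts G \<Longrightarrow> d \<le> card (neighbours G v)" "card (verts G) < 2 * d"
  shows "sn G = enat (card (verts G) - card I) \<and> gon G = int (card (verts G) - card I)"
proof -
  define m where "m = card (verts G) - card I"
  define D :: "'a \<Rightarrow> int" where "D = (\<lambda>v. of_bool (v \<in> verts G - I))"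
  have fin: "finite (verts G)" and IV: "I \<subseteq> verts G"
    using G I by (auto simp: simple_graph_def independent_set_def)
  have V: "verts G \<noteq> {}"
    using I IV by auto
  have order: "enat m \<le> scramble_order G (edges G)"
    unfolding m_def using I finite_subset[OF IV fin]
    by (intro scramble_order_edges_ge[OF G I(3) _ d]) (auto simp: Suc_le_eq card_gt_0_iff)
  have "neighbours G v \<noteq> {}" if "v \<in> I" for v
    using d(1)[of v] d(2) IV that by auto
  then have rkD: "rk G D \<ge> 1"
    unfolding D_def by (rule rk_complement_independent_set[OF G I(1,2)])
  have "deg G D = int (card (verts G - I))"
    using fin by (simp add: deg_def D_def of_bool_def sum.If_cases Diff_eq Compl_eq)
  then have degD: "deg G D = int m"
    using IV fin by (simp add: m_def card_Diff_subset finite_subset)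
  have "gon G = int m"
    unfolding gon_def
  proof (rule Least_equality)
    show "\<exists>D. divisor G D \<and> 1 \<le> rk G D \<and> deg G D = int m"
      using rkD degD by (intro exI[of _ D]) (auto simp: D_def divisor_def)
  next
    fix r assume "\<exists>D. divisor G D \<and> 1 \<le> rk G D \<and> deg G D = r"
    then obtain E where E: "rk G E \<ge> 1" "deg G E = r" by blast
    have "enat m \<le> enat (nat r)"
      using order_trans[OF order scramble_order_le_deg[OF G scramble_edges[OF G] E(1) V]] E(2) by simp
    \<comment> \<open>\<open>nat\<close> sends negative degrees to 0, so they are excluded
      separately.\<close>
    moreover have "r \<ge> 0"
      using E rk_ge_1_iff[OF G V] equiv_to_effective_deg[OF G] by blast
    ultimately show "int m \<le> r" by simp
  qed
  moreover have "sn G = enat m"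
  proof -
    have le: "scramble_order G S \<le> enat m" if "scramble G S" for S
      using scramble_order_le_deg[OF G that rkD V] unfolding degD nat_int .
    have "{scramble_order G S |S. scramble G S} \<subseteq> scramble_order G ` Pow (Pow (verts G))"
      by (auto simp: scramble_def egg_def)
    then have "finite {scramble_order G S |S. scramble G S}"
      using finite_surj[of "Pow (Pow (verts G))"] fin by simp
    moreover have "x \<le> enat m" if "x \<in> {scramble_order G S |S. scramble G S}" for x
      using that le by blast
    moreover have "enat m \<in> {scramble_order G S |S. scramble G S}"
      using antisym[OF order le[OF scramble_edges[OF G]]] scramble_edges[OF G] by blast
    ultimately show ?thesis
      unfolding sn_def by (intro Max_eqI)
  qed
  ultimately show ?thesis
    by (simp add: m_def)
qed

section \<open>Kneser graphs\<close>

lemma verts_kneser: "verts (kneser n k) = {A. A \<subseteq> {1..n} \<and> card A = k}"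
  by (simp add: kneser_def Let_def)

lemma kneser_edge_iff:
  "{A, B} \<in> edges (kneser n k) \<longleftrightarrow>
    A \<in> verts (kneser n k) \<and> B \<in> verts (kneser n k) \<and> A \<noteq> B \<and> A \<inter> B = {}"
  by (auto simp: kneser_def Let_def doubleton_eq_iff)

lemma simple_graph_kneser: "simple_graph (kneser n k)"
  unfolding simple_graph_def
proof (intro conjI ballI)
  fix e assume "e \<in> edges (kneser n k)"
  then show "\<exists>u v. e = {u, v} \<and> u \<noteq> v \<and> u \<in> verts (kneser n k) \<and> v \<in> verts (kneser n k)"
    unfolding kneser_def Let_def by auto
qed (simp add: verts_kneser)

text \<open>For \<open>k \<ge> 1\<close> a set disjoint from \<open>A\<close> differs from
  \<open>A\<close>, so the neighbours are all \<open>k\<close>-subsets of the complement of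
  \<open>A\<close>.\<close>

lemma card_neighbours_kneser:
  assumes "k \<ge> 1" "A \<in> verts (kneser n k)"
  shows "card (neighbours (kneser n k) A) = (n - k) choose k"
proof -
  have A: "A \<subseteq> {1..n}" "card A = k" "A \<noteq> {}"
    using assms by (auto simp: verts_kneser)
  then have "neighbours (kneser n k) A = {B. B \<subseteq> {1..n} - A \<and> card B = k}"
    using assms(2) by (auto simp: neighbours_def kneser_edge_iff verts_kneser)
  moreover have "card ({1..n} - A) = n - k"
    using A by (simp add: card_Diff_subset finite_subset)
  ultimately show ?thesis
    using n_subsets[of "{1..n} - A" k] by simp
qed

theorem theorem1p1:
  fixes n k :: nat
  assumes "n \<ge> 1" and "k \<ge> 1"
    and "real n \<ge> (3 * real k ^ 2 + real k + 2) / 2"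
  shows "sn (kneser n k) = enat ((n - 1) choose k) \<and>
         gon (kneser n k) = int ((n - 1) choose k)"
proof -
  define G where "G = kneser n k"
  \<comment> \<open>The star of all vertices containing \<open>n\<close>; the other vertices are the
    \<open>k\<close>-subsets of \<open>{1..n-1}\<close>.\<close>
  define I where "I = {A \<in> verts G. n \<in> A}"
  have "real (3 * k\<^sup>2 + k + 2) \<le> real (2 * n)"
    using assms(3) by simp
  then have kn: "3 * k\<^sup>2 + k + 2 \<le> 2 * n"
    by (simp only: of_nat_le_iff)
  moreover have "k \<le> k\<^sup>2"
    using assms(2) by (simp add: power2_eq_square)
  ultimately have k2: "2 * k \<le> n"
    by linarith
  have N: "card (verts G) = n choose k" and fin: "finite (verts G)"
    using n_subsets[of "{1..n}" k] by (simp_all add: G_def verts_kneser)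
  have "{1..n} - {n} = {1..n-1}"
    using assms(1) by auto
  then have "verts G - I = {A. A \<subseteq> {1..n-1} \<and> card A = k}"
    unfolding I_def G_def verts_kneser by blast
  then have "card (verts G - I) = (n - 1) choose k"
    using n_subsets[of "{1..n-1}" k] by simp
  moreover have "card (verts G - I) = card (verts G) - card I" "card I \<le> card (verts G)"
    using fin by (auto simp: I_def card_Diff_subset intro: card_mono)
  moreover have "n choose k = ((n - 1) choose (k - 1)) + ((n - 1) choose k)"
    using assms by (intro choose_reduce_nat) auto
  ultimately have I: "card (verts G) - card I = (n - 1) choose k" "card I = (n - 1) choose (k - 1)"
    using N by linarith+
  have "(n - 1) choose (k - 1) > 0"
    using k2 assms(2) by (simp add: zero_less_binomial)
  with I have "I \<noteq> {}"
    by auto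
  moreover have "independent_set G I"
    by (auto simp: independent_set_def I_def G_def kneser_edge_iff)
  moreover have "card F \<le> card I" if "independent_set G F" for F
    unfolding I(2)
  \<comment> \<open>Distinct members of an independent set intersect because they are not adjacent;
    a member meets itself because \<open>k \<ge> 1\<close>.\<close>
  proof (rule Erdos_Ko_Rado[of "{1..n}"])
    show F: "F \<subseteq> {A. A \<subseteq> {1..n} \<and> card A = k}"
      using that by (simp add: independent_set_def G_def verts_kneser)
    fix A B assume AB: "A \<in> F" "B \<in> F"
    then have "A \<noteq> {}"
      using F assms(2) by auto
    moreover have "{A, B} \<notin> edges G" "A \<in> verts G" "B \<in> verts G"
      using AB that by (auto simp: independent_set_def)
    ultimately show "A \<inter> B \<noteq> {}"
      unfolding G_def kneser_edge_iff by auto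
  qed (use assms(2) k2 in auto)
  moreover have "card (verts G) < 2 * ((n - k) choose k)"
    using binomial_less_twice_degree[OF assms(2) kn] N by simp
  ultimately show ?thesis
    using sn_gon_eq_card_diff_independent[of G I "(n - k) choose k"] simple_graph_kneser
      card_neighbours_kneser[OF assms(2)] I(1) by (simp add: G_def)
qed

end
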